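(* For any $F\in\mathbb{R}^2$, $F\neq0$, there exist $U_F\in C^\infty(\mathbb{R}^2;\mathbb{R}^2)$, $P_F\in C^\infty(\mathbb{R}^2;\mathbb{R})$ and $f\in C^\infty(\mathbb{R}^2;\mathbb{R}^2)$ satisfying the Navier-Stokes equations $$\Delta U_F-\nabla P_F=U_F\cdot\nabla U_F+f,\qquad \nabla\cdot U_F=0\quad\text{in }\mathbb{R}^2,$$ with net force $F$, such that, as $|x|\to\infty$, $$U_F=O(|x|^{-1/3}),\qquad P_F=O(|x|^{-2/3}),\qquad f=\bigl(O(|x|^{-7/3}),O(|x|^{-8/3})\bigr),$$ where the two components of $f$ are those along $F$ and along $F^\perp$ respectively.
   Context: For $v=(v_1,v_2)\in\mathbb{R}^2$, $v^\perp=(-v_2,v_1)$. The net force of a solution is $\int_{\mathbb{R}^2}f=\lim_{R\to\infty}\int_{\partial B(0,R)}\mathbf{T}n$, where $n$ is the outward unit normal and $\mathbf{T}=\nabla U_F+(\nabla U_F)^T-P_F\mathbf{1}-U_F\otimes U_F$. *)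

theory Defs
  imports "HOL-Analysis.Analysis" "HOL-Library.Landau_Symbols"
begin

definition partial :: "2 \<Rightarrow> (real^2 \<Rightarrow> 'b::real_normed_vector) \<Rightarrow> real^2 \<Rightarrow> 'b" where
  "partial i g x = frechet_derivative g (at x) (axis i 1)"

text \<open>
  Everywhere Frechet differentiable with all first partial derivatives of class
  \<open>C\<close> to the \<open>k\<close>.  Differentiability is required explicitly because
  \<^const>\<open>frechet_derivative\<close> is unspecified where it fails.
\<close>
primrec C_k :: "nat \<Rightarrow> (real^2 \<Rightarrow> 'b::real_normed_vector) \<Rightarrow> bool" where
  "C_k 0 g \<longleftrightarrow> continuous_on UNIV g"
| "C_k (Suc k) g \<longleftrightarrow> (\<forall>x. g differentiable (at x)) \<and> (\<forall>i. C_k k (partial i g))"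

definition smooth :: "(real^2 \<Rightarrow> 'b::real_normed_vector) \<Rightarrow> bool" where
  "smooth g \<longleftrightarrow> (\<forall>k. C_k k g)"

definition perp :: "real^2 \<Rightarrow> real^2" where
  "perp v = vector [- (v $ 2), v $ 1]"

definition gradient :: "(real^2 \<Rightarrow> real) \<Rightarrow> real^2 \<Rightarrow> real^2" where
  "gradient p x = (\<chi> i. partial i p x)"

definition divergence :: "(real^2 \<Rightarrow> real^2) \<Rightarrow> real^2 \<Rightarrow> real" where
  "divergence u x = (\<Sum>i\<in>UNIV. partial i u x $ i)"

definition laplacian :: "(real^2 \<Rightarrow> 'b::real_normed_vector) \<Rightarrow> real^2 \<Rightarrow> 'b" where
  "laplacian u x = (\<Sum>i\<in>UNIV. partial i (partial i u) x)"

definition advection :: "(real^2 \<Rightarrow> real^2) \<Rightarrow> (real^2 \<Rightarrow> 'b::real_normed_vector) \<Rightarrow> real^2 \<Rightarrow> 'b" where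
  "advection u w x = (\<Sum>j\<in>UNIV. (u x $ j) *\<^sub>R partial j w x)"

definition navier_stokes ::
  "(real^2 \<Rightarrow> real^2) \<Rightarrow> (real^2 \<Rightarrow> real) \<Rightarrow> (real^2 \<Rightarrow> real^2) \<Rightarrow> bool" where
  "navier_stokes U P f \<longleftrightarrow>
     (\<forall>x. laplacian U x - gradient P x = advection U U x + f x \<and> divergence U x = 0)"

definition tensor_product :: "real^2 \<Rightarrow> real^2 \<Rightarrow> real^2^2" where
  "tensor_product v w = (\<chi> i j. v $ i * w $ j)"

text \<open>
  The sum of \<open>\<nabla>u\<close> and its transpose does not depend on which index convention is used
  for \<open>\<nabla>u\<close>; \<^term>\<open>mat c\<close> is \<open>c\<close> times the identity matrix.
\<close>
definition stress_tensor :: "(real^2 \<Rightarrow> real^2) \<Rightarrow> (real^2 \<Rightarrow> real) \<Rightarrow> real^2 \<Rightarrow> real^2^2" where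
  "stress_tensor u p x =
     jacobian u (at x) + transpose (jacobian u (at x))
       - mat (p x) - tensor_product (u x) (u x)"

definition unit_normal :: "real \<Rightarrow> real^2" where
  "unit_normal t = vector [cos t, sin t]"

text \<open>
  The integral of \<open>T n\<close> over the circle of radius \<open>R\<close> about the origin, in the
  parametrisation \<open>t \<mapsto> R n(t)\<close>, whose arc length element is \<open>R dt\<close>.
\<close>
definition circle_flux :: "(real^2 \<Rightarrow> real^2^2) \<Rightarrow> real \<Rightarrow> real^2" where
  "circle_flux T R =
     integral {0..2*pi} (\<lambda>t. R *\<^sub>R (T (R *\<^sub>R unit_normal t) *v unit_normal t))"

text \<open>
  The net force is given by two expressions, the integral of \<open>f\<close> over the plane and the
  limit of the boundary integrals of the stress tensor; both are required to have the value
  \<open>F\<close>.  Integrability is explicit since \<^const>\<open>lebesgue_integral\<close> is \<open>0\<close> without it.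
\<close>
definition has_net_force ::
  "(real^2 \<Rightarrow> real^2) \<Rightarrow> (real^2 \<Rightarrow> real) \<Rightarrow> (real^2 \<Rightarrow> real^2) \<Rightarrow> real^2 \<Rightarrow> bool" where
  "has_net_force U P f F \<longleftrightarrow>
     integrable lborel f \<and> integral\<^sup>L lborel f = F \<and>
     (circle_flux (stress_tensor U P) \<longlongrightarrow> F) at_top"

definition component_along :: "real^2 \<Rightarrow> real^2 \<Rightarrow> real" where
  "component_along v w = (w \<bullet> v) / norm v"

end

theory Submission
  imports Defs "HOL-Real_Asymp.Real_Asymp"
begin

text \<open>
  The solution is a smoothed plane jet.  In coordinates \<open>(x, y)\<close> in which the jet points along
  the positive \<open>x\<close>-axis, the boundary layer equation \<open>u u\<^sub>x + v u\<^sub>y = u\<^sub>y\<^sub>y\<close> has the similarity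
  solution with stream function \<open>6 x\<^bsup>1/3\<^esup> tanh (y x\<^bsup>-2/3\<^esup>)\<close>, the Bickley jet: \<open>u\<close> is of size
  \<open>x\<^bsup>-1/3\<^esup>\<close> in a layer of width \<open>x\<^bsup>2/3\<^esup>\<close>, and the momentum \<open>u\<^sup>2\<close> that it carries through a
  line \<open>x = const\<close> is \<open>48\<close>, whatever \<open>x\<close> is.  To get a field on the whole plane, put
  \<open>\<rho> = sqrt (1 + x\<^sup>2 + y\<^sup>2)\<close>, \<open>\<xi> = x / \<rho>\<close>, \<open>\<sigma> = y \<rho>\<^bsup>-2/3\<^esup>\<close> and take the stream function
  \<open>\<psi> = 3 \<rho>\<^bsup>1/3\<^esup> (1 + \<xi>) tanh \<sigma>\<close>.  It is smooth, and near the positive \<open>x\<close>-axis it agrees with the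
  Bickley jet up to a relative error \<open>\<rho>\<^bsup>-2/3\<^esup>\<close>, because \<open>\<rho> / x - 1\<close> and \<open>1 - \<xi>\<close> are of the
  order of \<open>(1 + y\<^sup>2) / x\<^sup>2\<close>; the factor \<open>1 + \<xi>\<close> switches the jet off at the negative \<open>x\<close>-axis.

  The first component of the force, \<open>\<Delta>u - p\<^sub>x - u u\<^sub>x - v u\<^sub>y\<close>, contains terms of size \<open>\<rho>\<^bsup>-5/3\<^esup>\<close>, which
  cancel by the boundary layer equation.  The second component contains terms of size
  \<open>\<rho>\<^sup>-\<^sup>2\<close>, which the pressure has to balance.  It is
  chosen as \<open>p = v\<^sub>y - v\<^sup>2 + q\<^sub>x\<close> with an explicit \<open>q\<close> such that \<open>q\<^sub>y + u v = O(\<rho>\<^bsup>-5/3\<^esup>)\<close>, for then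
  incompressibility turns the second component into \<open>v\<^sub>x\<^sub>x - (q\<^sub>y + u v)\<^sub>x = O(\<rho>\<^bsup>-8/3\<^esup>)\<close>.

  All estimates rest on an algebra of functions graded by the power of \<open>\<rho>\<^bsup>-1/3\<^esup>\<close>
  (\<open>symb\<close> below), which is closed under differentiation: \<open>\<partial>\<^sub>x\<close> and \<open>y/\<rho> \<partial>\<^sub>y\<close> gain three powers, and
  \<open>\<partial>\<^sub>y\<close> gains two.  Membership gives smoothness and decay at once, so that only the cancellations
  just described have to be computed (\<open>symb_force1\<close>, \<open>symb_force2\<close>).

  For the net force, the only part of the stress that contributes in the limit is \<open>- u\<^sup>2\<close> in the
  right half plane.  On a circle and on a vertical line it is, up to negligible terms, the exact
  derivative of a function of \<open>\<sigma>\<close>; this gives the flux \<open>- 48\<close> in the \<open>x\<close>-direction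
  (\<open>circle_flux1\<close>, \<open>box_flux\<close>), and reflection in the \<open>x\<close>-axis gives \<open>0\<close> in the \<open>y\<close>-direction.  The
  integral of the force is the limit of its integrals over squares, which are boundary fluxes as
  the force is the divergence of the stress.  Finally, \<open>(x, y) = (k \<bullet> p, k\<^sup>\<bottom> \<bullet> p)\<close>
  with \<open>k = - F / 48\<close> places the jet opposite to \<open>F\<close>; the scaling symmetry of the equations makes
  \<open>|k|\<close> the right strength.
\<close>

section \<open>Gradients of scalar functions on the coordinate plane\<close>

text \<open>
  The construction lives on \<^typ>\<open>real \<times> real\<close>.  \<open>has_grad g gx gy\<close> says that \<open>g\<close> is everywhere Frechet
  differentiable with partial derivatives \<open>gx\<close> and \<open>gy\<close>; \<open>dx\<close> and \<open>dy\<close> are the corresponding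
  operators.
\<close>

definition has_grad :: "(real \<times> real \<Rightarrow> real) \<Rightarrow> (real \<times> real \<Rightarrow> real) \<Rightarrow> (real \<times> real \<Rightarrow> real) \<Rightarrow> bool" where
  "has_grad g gx gy \<longleftrightarrow> (\<forall>z. (g has_derivative (\<lambda>h. gx z * fst h + gy z * snd h)) (at z))"

definition dx :: "(real \<times> real \<Rightarrow> real) \<Rightarrow> real \<times> real \<Rightarrow> real" where
  "dx g z = frechet_derivative g (at z) (1, 0)"

definition dy :: "(real \<times> real \<Rightarrow> real) \<Rightarrow> real \<times> real \<Rightarrow> real" where
  "dy g z = frechet_derivative g (at z) (0, 1)"

lemma has_grad_dx: "has_grad g gx gy \<Longrightarrow> dx g = gx"
  and has_grad_dy: "has_grad g gx gy \<Longrightarrow> dy g = gy"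
  unfolding has_grad_def dx_def dy_def fun_eq_iff
  by (metis (no_types, lifting) frechet_derivative_at fst_conv snd_conv mult.right_neutral mult_zero_right add_0_right add_0_left)+

lemma has_grad_cong:
  "has_grad g a b \<Longrightarrow> (\<And>z. a z = a' z) \<Longrightarrow> (\<And>z. b z = b' z) \<Longrightarrow> has_grad g a' b'"
  by (simp add: has_grad_def)

named_theorems grad

lemma has_grad_const [grad]: "has_grad (\<lambda>_. c) (\<lambda>_. 0) (\<lambda>_. 0)"
  by (simp add: has_grad_def)

lemma has_grad_fst: "has_grad fst (\<lambda>_. 1) (\<lambda>_. 0)"
  and has_grad_snd: "has_grad snd (\<lambda>_. 0) (\<lambda>_. 1)"
  unfolding has_grad_def by (auto intro!: derivative_eq_intros)

lemma has_grad_add [grad]: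
  "has_grad f fx fy \<Longrightarrow> has_grad g gx gy \<Longrightarrow>
    has_grad (\<lambda>z. f z + g z) (\<lambda>z. fx z + gx z) (\<lambda>z. fy z + gy z)"
  unfolding has_grad_def by (auto intro!: derivative_eq_intros simp: algebra_simps)

lemma has_grad_diff [grad]:
  "has_grad f fx fy \<Longrightarrow> has_grad g gx gy \<Longrightarrow>
    has_grad (\<lambda>z. f z - g z) (\<lambda>z. fx z - gx z) (\<lambda>z. fy z - gy z)"
  unfolding has_grad_def by (auto intro!: derivative_eq_intros simp: algebra_simps)

lemma has_grad_minus [grad]:
  "has_grad f fx fy \<Longrightarrow> has_grad (\<lambda>z. - f z) (\<lambda>z. - fx z) (\<lambda>z. - fy z)"
  unfolding has_grad_def by (auto intro!: derivative_eq_intros simp: algebra_simps)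

lemma has_grad_mult [grad]:
  "has_grad f fx fy \<Longrightarrow> has_grad g gx gy \<Longrightarrow>
    has_grad (\<lambda>z. f z * g z) (\<lambda>z. fx z * g z + f z * gx z) (\<lambda>z. fy z * g z + f z * gy z)"
  unfolding has_grad_def by (auto intro!: derivative_eq_intros simp: algebra_simps)

lemma has_grad_comp:
  assumes "has_grad g gx gy" "\<And>z. (h has_field_derivative h' z) (at (g z))"
  shows "has_grad (\<lambda>z. h (g z)) (\<lambda>z. h' z * gx z) (\<lambda>z. h' z * gy z)"
  unfolding has_grad_def
proof
  fix z
  have "((\<lambda>z. h (g z)) has_derivative (\<lambda>a. h' z * (gx z * fst a + gy z * snd a))) (at z)"
    using has_derivative_compose[of g "\<lambda>a. gx z * fst a + gy z * snd a" z UNIV h "(*) (h' z)"] assms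
    unfolding has_grad_def has_field_derivative_def by blast
  then show "((\<lambda>z. h (g z)) has_derivative
      (\<lambda>a. h' z * gx z * fst a + h' z * gy z * snd a)) (at z)"
    by (simp add: algebra_simps)
qed

lemma has_grad_power [grad]:
  "has_grad f fx fy \<Longrightarrow>
    has_grad (\<lambda>z. f z ^ n) (\<lambda>z. of_nat n * f z ^ (n - 1) * fx z) (\<lambda>z. of_nat n * f z ^ (n - 1) * fy z)"
  by (rule has_grad_comp, assumption) (auto intro!: derivative_eq_intros)

section \<open>The generating functions\<close>

text \<open>
  With \<open>\<rho> = sqrt (1 + x\<^sup>2 + y\<^sup>2)\<close>: \<open>lam = \<rho>\<^bsup>-1/3\<^esup>\<close> measures decay, \<open>xi = x / \<rho>\<close> and
  \<open>ze = y / \<rho>\<close> are the angular variables, \<open>sg = y \<rho>\<^bsup>-2/3\<^esup>\<close> is the similarity variable across the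
  jet, and \<open>th\<close>, \<open>sech2\<close> are the tanh and the squared sech of \<open>sg\<close>.  The last one, \<open>logp\<close>, is the
  antiderivative of \<open>- s sech\<^sup>2 s\<close> that tends to \<open>0\<close> at infinity, which the pressure requires.  Their
  first derivatives are polynomials in these functions.
\<close>

definition lam :: "real \<times> real \<Rightarrow> real" where
  "lam z = (1 + fst z ^ 2 + snd z ^ 2) powr (- 1 / 6)"

definition xi :: "real \<times> real \<Rightarrow> real" where "xi z = fst z * lam z ^ 3"

definition ze :: "real \<times> real \<Rightarrow> real" where "ze z = snd z * lam z ^ 3"

definition sg :: "real \<times> real \<Rightarrow> real" where "sg z = snd z * lam z ^ 2"

definition th :: "real \<times> real \<Rightarrow> real" where "th z = tanh (sg z)"

definition sech2 :: "real \<times> real \<Rightarrow> real" where "sech2 z = 1 - th z ^ 2"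

definition logp :: "real \<times> real \<Rightarrow> real" where
  "logp z = ln (2 * cosh (sg z)) - sg z * tanh (sg z)"

lemma one_plus_pos: "1 + x ^ 2 + y ^ 2 > (0::real)"
  by (metis add_pos_nonneg zero_le_power2 zero_less_one)

lemma lam_pos: "lam z > 0"
  using one_plus_pos[of "fst z" "snd z"] by (simp add: lam_def)

lemma lam_6: "lam z ^ 6 * (1 + fst z ^ 2 + snd z ^ 2) = 1"
proof -
  have "lam z ^ 6 = (1 + fst z ^ 2 + snd z ^ 2) powr (-1)"
    using one_plus_pos[of "fst z" "snd z"]
    by (simp add: lam_def powr_realpow[symmetric] powr_powr)
  then show ?thesis
    using one_plus_pos[of "fst z" "snd z"] by (simp add: powr_minus)
qed

text \<open>
  The two relations \<open>lam\<^sup>6 + xi\<^sup>2 + ze\<^sup>2 = 1\<close> and \<open>ze = sg lam\<close> are the source of every gain below: a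
  factor \<open>ze\<close> next to a function that decays rapidly in \<open>sg\<close> is worth one power of \<open>lam\<close>, and a factor
  \<open>1 - xi\<^sup>2\<close> is worth two.
\<close>

lemma unit_sphere: "lam z ^ 6 + xi z ^ 2 + ze z ^ 2 = 1"
  using lam_6[of z] by (simp add: xi_def ze_def power_mult_distrib algebra_simps flip: power_mult)

lemma ze_eq: "ze z = sg z * lam z"
  by (simp add: ze_def sg_def power2_eq_square power3_eq_cube)

lemma th_eq: "th z ^ 2 = 1 - sech2 z"
  by (simp add: sech2_def)

lemma has_grad_lam [grad]:
  "has_grad lam (\<lambda>z. - (lam z ^ 4 * xi z) / 3) (\<lambda>z. - (lam z ^ 4 * ze z) / 3)"
proof -
  let ?q = "\<lambda>z::real\<times>real. 1 + fst z ^ 2 + snd z ^ 2"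
  have q: "has_grad ?q (\<lambda>z. 2 * fst z) (\<lambda>z. 2 * snd z)"
    unfolding has_grad_def by (auto intro!: derivative_eq_intros)
  have "has_grad (\<lambda>z. ?q z powr (-1/6)) (\<lambda>z. ((-1/6) * ?q z powr (-1/6 - 1)) * (2 * fst z))
      (\<lambda>z. ((-1/6) * ?q z powr (-1/6 - 1)) * (2 * snd z))"
    by (rule has_grad_comp[OF q], rule has_real_derivative_powr, rule one_plus_pos)
  moreover have "?q z powr (-1/6 - 1) = lam z ^ 4 * lam z ^ 3" for z
    using one_plus_pos[of "fst z" "snd z"]
    by (simp add: lam_def powr_realpow[symmetric] powr_powr flip: powr_add)
  ultimately have "has_grad (\<lambda>z. ?q z powr (-1/6))
      (\<lambda>z. - (lam z ^ 4 * xi z) / 3) (\<lambda>z. - (lam z ^ 4 * ze z) / 3)"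
    by (elim has_grad_cong) (simp_all only: xi_def ze_def, simp_all)
  then show ?thesis by (simp add: lam_def[abs_def])
qed

lemma has_grad_xi [grad]:
  "has_grad xi (\<lambda>z. lam z ^ 3 * (1 - xi z ^ 2)) (\<lambda>z. - (lam z ^ 3 * xi z * ze z))"
proof -
  have "has_grad (\<lambda>z. fst z * lam z ^ 3)
    (\<lambda>z. lam z ^ 3 * (1 - xi z ^ 2)) (\<lambda>z. - (lam z ^ 3 * xi z * ze z))"
    by (rule has_grad_cong, (rule grad has_grad_fst)+)
       (simp_all add: xi_def ze_def algebra_simps numeral_eq_Suc)
  then show ?thesis by (simp add: xi_def[abs_def])
qed

lemma has_grad_ze [grad]:
  "has_grad ze (\<lambda>z. - (lam z ^ 3 * xi z * ze z)) (\<lambda>z. lam z ^ 3 * (1 - ze z ^ 2))"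
proof -
  have "has_grad (\<lambda>z. snd z * lam z ^ 3)
    (\<lambda>z. - (lam z ^ 3 * xi z * ze z)) (\<lambda>z. lam z ^ 3 * (1 - ze z ^ 2))"
    by (rule has_grad_cong, (rule grad has_grad_snd)+)
       (simp_all add: xi_def ze_def algebra_simps numeral_eq_Suc)
  then show ?thesis by (simp add: ze_def[abs_def])
qed

lemma has_grad_sg [grad]:
  "has_grad sg (\<lambda>z. - (2 / 3) * lam z ^ 3 * xi z * sg z)
     (\<lambda>z. lam z ^ 2 - (2 / 3) * lam z ^ 3 * ze z * sg z)"
proof -
  have "has_grad (\<lambda>z. snd z * lam z ^ 2) (\<lambda>z. - (2 / 3) * lam z ^ 3 * xi z * sg z)
     (\<lambda>z. lam z ^ 2 - (2 / 3) * lam z ^ 3 * ze z * sg z)"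
    by (rule has_grad_cong, (rule grad has_grad_snd)+)
       (simp_all add: xi_def ze_def sg_def algebra_simps numeral_eq_Suc)
  then show ?thesis by (simp add: sg_def[abs_def])
qed

text \<open>
The partial derivatives of \<open>sg\<close>.
\<close>

abbreviation "sgx z \<equiv> - (2 / 3) * lam z ^ 3 * xi z * sg z"
abbreviation "sgy z \<equiv> lam z ^ 2 - (2 / 3) * lam z ^ 3 * ze z * sg z"

lemma has_grad_th [grad]:
  "has_grad th (\<lambda>z. sech2 z * sgx z) (\<lambda>z. sech2 z * sgy z)"
proof -
  have "has_grad (\<lambda>z. tanh (sg z)) (\<lambda>z. (1 - tanh (sg z) ^ 2) * sgx z) (\<lambda>z. (1 - tanh (sg z) ^ 2) * sgy z)"
    by (rule has_grad_comp, rule grad) (auto intro!: derivative_eq_intros)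
  then show ?thesis by (simp add: th_def[abs_def] sech2_def)
qed

lemma has_grad_sech2 [grad]:
  "has_grad sech2 (\<lambda>z. - 2 * th z * sech2 z * sgx z) (\<lambda>z. - 2 * th z * sech2 z * sgy z)"
proof -
  have "has_grad (\<lambda>z. 1 - th z ^ 2) (\<lambda>z. - 2 * th z * sech2 z * sgx z) (\<lambda>z. - 2 * th z * sech2 z * sgy z)"
    by (rule has_grad_cong, (rule grad)+) simp_all
  then show ?thesis by (simp add: sech2_def[abs_def])
qed

lemma has_grad_logp [grad]:
  "has_grad logp (\<lambda>z. - sg z * sech2 z * sgx z) (\<lambda>z. - sg z * sech2 z * sgy z)"
proof -
  have D: "((\<lambda>s. ln (2 * cosh s) - s * tanh s) has_field_derivative - s * (1 - tanh s ^ 2)) (at s)" for s :: real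
    by (auto intro!: derivative_eq_intros simp: tanh_def field_simps power2_eq_square)
  have "has_grad (\<lambda>z. ln (2 * cosh (sg z)) - sg z * tanh (sg z))
      (\<lambda>z. (- sg z * (1 - tanh (sg z) ^ 2)) * sgx z) (\<lambda>z. (- sg z * (1 - tanh (sg z) ^ 2)) * sgy z)"
    by (rule has_grad_comp[OF has_grad_sg D])
  then show ?thesis by (simp add: logp_def[abs_def] sech2_def th_def)
qed

section \<open>The graded algebra of symbols\<close>

text \<open>
  \<open>symb n g\<close>: the function \<open>g\<close> is a symbol of order \<open>n\<close>, hence \<open>O(\<rho>\<^bsup>-n/3\<^esup>)\<close>.  The unbounded
  variable \<open>sg\<close> is admitted only in products with one of the rapidly decaying profiles \<open>sech2\<close> and
  \<open>logp\<close>; these products are the functions concentrated in the jet.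
\<close>

inductive symb :: "nat \<Rightarrow> (real \<times> real \<Rightarrow> real) \<Rightarrow> bool" where
  symb_const: "symb 0 (\<lambda>_. c)"
| symb_lam: "symb 1 lam"
| symb_xi: "symb 0 xi"
| symb_ze: "symb 0 ze"
| symb_th: "symb 0 th"
| symb_jet_sech2: "symb 0 (\<lambda>z. sg z ^ k * sech2 z)"
| symb_jet_logp: "symb 0 (\<lambda>z. sg z ^ k * logp z)"
| symb_add: "symb n f \<Longrightarrow> symb n g \<Longrightarrow> symb n (\<lambda>z. f z + g z)"
| symb_mult: "symb m f \<Longrightarrow> symb n g \<Longrightarrow> symb (m + n) (\<lambda>z. f z * g z)"
| symb_weaken: "symb (Suc n) f \<Longrightarrow> symb n f"

lemma symb_mono: "m \<le> n \<Longrightarrow> symb n f \<Longrightarrow> symb m f"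
proof (induction n)
  case (Suc n)
  then show ?case by (cases "m = Suc n") (auto intro: symb_weaken)
qed auto

lemma symb_mult0: "symb 0 f \<Longrightarrow> symb n g \<Longrightarrow> symb n (\<lambda>z. f z * g z)"
  using symb_mult[of 0 f n g] by simp

lemma symb_cmult: "symb n g \<Longrightarrow> symb n (\<lambda>z. c * g z)"
  by (rule symb_mult0[OF symb_const])

lemma symb_minus: "symb n g \<Longrightarrow> symb n (\<lambda>z. - g z)"
  using symb_cmult[of n g "-1"] by simp

lemma symb_diff: "symb n f \<Longrightarrow> symb n g \<Longrightarrow> symb n (\<lambda>z. f z - g z)"
  using symb_add[OF _ symb_minus] by fastforce

lemma symb_pow: "symb m f \<Longrightarrow> symb (k * m) (\<lambda>z. f z ^ k)"
proof (induction k)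
  case 0 show ?case using symb_const[of 1] by simp
next
  case (Suc k) then show ?case using symb_mult[of m f "k * m"] by simp
qed

lemma symb_lam_pow: "symb n (\<lambda>z. lam z ^ n)"
  using symb_pow[OF symb_lam, of n] by simp

lemma symb_zero: "symb n (\<lambda>_. 0)"
  using symb_mult[OF symb_const[of 0] symb_lam_pow[of n]] by simp

lemma symb_pow0: "symb 0 f \<Longrightarrow> symb 0 (\<lambda>z. f z ^ k)"
  using symb_pow[of 0 f k] by simp

lemma symb_lam_mult: "symb m g \<Longrightarrow> symb (n + m) (\<lambda>z. lam z ^ n * g z)"
  by (rule symb_mult[OF symb_lam_pow])

lemma symb_lam0: "symb 0 lam"
  by (rule symb_mono[OF _ symb_lam]) simp

lemma symb_sech2: "symb 0 sech2"
  using symb_jet_sech2[of 0] by simp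

lemma symb_logp: "symb 0 logp"
  using symb_jet_logp[of 0] by simp

lemma symb_sg_sech2: "symb 0 (\<lambda>z. sg z * sech2 z)"
  using symb_jet_sech2[of 1] by simp

text \<open>
  Rules that recognise symbols of order \<open>0\<close> syntactically, provided that each power of \<open>sg\<close> is
  bracketed with its profile.
\<close>

lemmas symb0_intros = symb_diff symb_minus symb_add symb_jet_sech2 symb_sg_sech2 symb_jet_logp symb_pow0 symb_sech2 symb_logp
  symb_lam0 symb_xi symb_ze symb_th symb_const symb_mult0

lemma symb_grad_sech2_jet:
  "has_grad (\<lambda>z. sg z ^ k * sech2 z)
    (\<lambda>z. lam z ^ 3 * (xi z * (- (2/3) * real k * (sg z ^ k * sech2 z) + (4/3) * (th z * (sg z ^ Suc k * sech2 z)))))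
    (\<lambda>z. lam z ^ 2 * (real k * (sg z ^ (k - 1) * sech2 z) - 2 * (th z * (sg z ^ k * sech2 z)))
       + lam z ^ 2 * (lam z ^ 2 * (- (2/3) * real k * (sg z ^ Suc k * sech2 z) + (4/3) * (th z * (sg z ^ Suc (Suc k) * sech2 z)))))"
proof (rule has_grad_cong, (rule grad)+)
  fix z
  show "real k * sg z ^ (k - 1) * sgx z * sech2 z + sg z ^ k * (- 2 * th z * sech2 z * sgx z) =
    lam z ^ 3 * (xi z * (- (2/3) * real k * (sg z ^ k * sech2 z) + (4/3) * (th z * (sg z ^ Suc k * sech2 z))))"
    by (cases k) (simp_all add: algebra_simps)
  show "real k * sg z ^ (k - 1) * sgy z * sech2 z + sg z ^ k * (- 2 * th z * sech2 z * sgy z) =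
    lam z ^ 2 * (real k * (sg z ^ (k - 1) * sech2 z) - 2 * (th z * (sg z ^ k * sech2 z)))
       + lam z ^ 2 * (lam z ^ 2 * (- (2/3) * real k * (sg z ^ Suc k * sech2 z) + (4/3) * (th z * (sg z ^ Suc (Suc k) * sech2 z))))"
    by (cases k) (simp_all add: ze_eq numeral_eq_Suc algebra_simps)
qed

lemma symb_grad_logp_jet:
  "has_grad (\<lambda>z. sg z ^ k * logp z)
    (\<lambda>z. lam z ^ 3 * (xi z * (- (2/3) * real k * (sg z ^ k * logp z) + (2/3) * (sg z ^ Suc (Suc k) * sech2 z))))
    (\<lambda>z. lam z ^ 2 * (real k * (sg z ^ (k - 1) * logp z) - sg z ^ Suc k * sech2 z)
       + lam z ^ 2 * (lam z ^ 2 * (- (2/3) * real k * (sg z ^ Suc k * logp z) + (2/3) * (sg z ^ Suc (Suc (Suc k)) * sech2 z))))"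
proof (rule has_grad_cong, (rule grad)+)
  fix z
  show "real k * sg z ^ (k - 1) * sgx z * logp z + sg z ^ k * (- sg z * sech2 z * sgx z) =
    lam z ^ 3 * (xi z * (- (2/3) * real k * (sg z ^ k * logp z) + (2/3) * (sg z ^ Suc (Suc k) * sech2 z)))"
    by (cases k) (simp_all add: algebra_simps)
  show "real k * sg z ^ (k - 1) * sgy z * logp z + sg z ^ k * (- sg z * sech2 z * sgy z) =
    lam z ^ 2 * (real k * (sg z ^ (k - 1) * logp z) - sg z ^ Suc k * sech2 z)
       + lam z ^ 2 * (lam z ^ 2 * (- (2/3) * real k * (sg z ^ Suc k * logp z) + (2/3) * (sg z ^ Suc (Suc (Suc k)) * sech2 z)))"
    by (cases k) (simp_all add: ze_eq numeral_eq_Suc algebra_simps)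
qed

text \<open>
  The standard way to determine an order: exhibit the power of \<open>lam\<close> and a remaining factor of order \<open>0\<close>.
\<close>

lemma symb_factor:
  assumes "symb 0 h" "\<And>z. g z = lam z ^ m * h z" "n \<le> m"
  shows "symb n g"
proof -
  have "g = (\<lambda>z. lam z ^ m * h z)" using assms(2) by auto
  then have "symb m g" using symb_lam_mult[OF assms(1), of m] by simp
  then show ?thesis using symb_mono assms(3) by blast
qed

lemma symb_cong: "symb n f \<Longrightarrow> (\<And>z. g z = f z) \<Longrightarrow> symb n g"
  by (metis ext)

text \<open>
  Differentiation in \<open>x\<close> gains three orders.  Differentiation in \<open>y\<close> gains only two, since \<open>sg\<close> varies
  on the scale \<open>\<rho>\<^bsup>2/3\<^esup>\<close>, but three after multiplication by \<open>ze\<close>.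
\<close>

lemma symb_grad:
  "symb n g \<Longrightarrow> \<exists>gx gy. has_grad g gx gy \<and> symb (n + 3) gx \<and> symb (n + 2) gy
    \<and> symb (n + 3) (\<lambda>z. ze z * gy z)"
proof (induction rule: symb.induct)
  case (symb_const c)
  show ?case by (intro exI conjI, rule has_grad_const) (simp_all add: symb_zero)
next
  case symb_lam
  show ?case
  proof (intro exI conjI)
    show "has_grad lam (\<lambda>z. - (lam z ^ 4 * xi z) / 3) (\<lambda>z. - (lam z ^ 4 * ze z) / 3)"
      by (rule has_grad_lam)
    show "symb (1 + 3) (\<lambda>z. - (lam z ^ 4 * xi z) / 3)"
      by (rule symb_factor[where m = 4 and h = "\<lambda>z. - (1/3) * xi z"]) (intro symb0_intros, simp_all)
    show "symb (1 + 2) (\<lambda>z. - (lam z ^ 4 * ze z) / 3)"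
      by (rule symb_factor[where m = 4 and h = "\<lambda>z. - (1/3) * ze z"]) (intro symb0_intros, simp_all)
    show "symb (1 + 3) (\<lambda>z. ze z * (- (lam z ^ 4 * ze z) / 3))"
      by (rule symb_factor[where m = 4 and h = "\<lambda>z. - (1/3) * (ze z * ze z)"]) (intro symb0_intros, simp_all)
  qed
next
  case symb_xi
  show ?case
  proof (intro exI conjI)
    show "has_grad xi (\<lambda>z. lam z ^ 3 * (1 - xi z ^ 2)) (\<lambda>z. - (lam z ^ 3 * xi z * ze z))"
      by (rule has_grad_xi)
    show "symb (0 + 3) (\<lambda>z. lam z ^ 3 * (1 - xi z ^ 2))"
      by (rule symb_factor[where m = 3 and h = "\<lambda>z. 1 - xi z ^ 2"]) (intro symb0_intros, simp_all)
    show "symb (0 + 2) (\<lambda>z. - (lam z ^ 3 * xi z * ze z))"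
      by (rule symb_factor[where m = 3 and h = "\<lambda>z. - (xi z * ze z)"]) (intro symb0_intros, simp_all)
    show "symb (0 + 3) (\<lambda>z. ze z * - (lam z ^ 3 * xi z * ze z))"
      by (rule symb_factor[where m = 3 and h = "\<lambda>z. - (xi z * (ze z * ze z))"]) (intro symb0_intros, simp_all)
  qed
next
  case symb_ze
  show ?case
  proof (intro exI conjI)
    show "has_grad ze (\<lambda>z. - (lam z ^ 3 * xi z * ze z)) (\<lambda>z. lam z ^ 3 * (1 - ze z ^ 2))"
      by (rule has_grad_ze)
    show "symb (0 + 3) (\<lambda>z. - (lam z ^ 3 * xi z * ze z))"
      by (rule symb_factor[where m = 3 and h = "\<lambda>z. - (xi z * ze z)"]) (intro symb0_intros, simp_all)
    show "symb (0 + 2) (\<lambda>z. lam z ^ 3 * (1 - ze z ^ 2))"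
      by (rule symb_factor[where m = 3 and h = "\<lambda>z. 1 - ze z ^ 2"]) (intro symb0_intros, simp_all)
    show "symb (0 + 3) (\<lambda>z. ze z * (lam z ^ 3 * (1 - ze z ^ 2)))"
      by (rule symb_factor[where m = 3 and h = "\<lambda>z. ze z * (1 - ze z ^ 2)"]) (intro symb0_intros, simp_all)
  qed
next
  case symb_th
  show ?case
  proof (intro exI conjI)
    show "has_grad th (\<lambda>z. sech2 z * sgx z) (\<lambda>z. sech2 z * sgy z)"
      by (rule has_grad_th)
    show "symb (0 + 3) (\<lambda>z. sech2 z * sgx z)"
      by (rule symb_factor[where m = 3 and h = "\<lambda>z. - (2/3) * (xi z * (sg z * sech2 z))"])
        (intro symb0_intros, simp_all)
    show "symb (0 + 2) (\<lambda>z. sech2 z * sgy z)"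
      by (rule symb_factor[where m = 2 and h = "\<lambda>z. sech2 z - (2/3) * (lam z ^ 2 * (sg z ^ 2 * sech2 z))"])
        (intro symb0_intros, simp_all add: ze_eq algebra_simps numeral_eq_Suc)
    show "symb (0 + 3) (\<lambda>z. ze z * (sech2 z * sgy z))"
      by (rule symb_factor[where m = 3 and h = "\<lambda>z. sg z * sech2 z - (2/3) * (lam z ^ 2 * (sg z ^ 3 * sech2 z))"])
        (intro symb0_intros, simp_all add: ze_eq algebra_simps numeral_eq_Suc)
  qed
next
  case (symb_jet_sech2 k)
  show ?case
  proof (intro exI conjI)
    show "symb (0 + 3) (\<lambda>z. lam z ^ 3 * (xi z * (- (2/3) * real k * (sg z ^ k * sech2 z)
        + (4/3) * (th z * (sg z ^ Suc k * sech2 z)))))"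
      by (rule symb_factor[where m = 3, rotated]) (rule refl, simp, intro symb0_intros)
    show "symb (0 + 2) (\<lambda>z. lam z ^ 2 * (real k * (sg z ^ (k - 1) * sech2 z) - 2 * (th z * (sg z ^ k * sech2 z)))
       + lam z ^ 2 * (lam z ^ 2 * (- (2/3) * real k * (sg z ^ Suc k * sech2 z) + (4/3) * (th z * (sg z ^ Suc (Suc k) * sech2 z)))))"
      (is "symb _ (\<lambda>z. lam z ^ 2 * ?A z + lam z ^ 2 * ?B z)")
      by (rule symb_factor[where m = 2 and h = "\<lambda>z. ?A z + ?B z"])
        (intro symb0_intros, simp_all add: distrib_left)
    show "symb (0 + 3) (\<lambda>z. ze z * (lam z ^ 2 * (real k * (sg z ^ (k - 1) * sech2 z) - 2 * (th z * (sg z ^ k * sech2 z)))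
       + lam z ^ 2 * (lam z ^ 2 * (- (2/3) * real k * (sg z ^ Suc k * sech2 z) + (4/3) * (th z * (sg z ^ Suc (Suc k) * sech2 z))))))"
      by (rule symb_factor[where m = 3 and h = "\<lambda>z. (real k * (sg z ^ k * sech2 z) - 2 * (th z * (sg z ^ Suc k * sech2 z)))
       + lam z ^ 2 * (- (2/3) * real k * (sg z ^ Suc (Suc k) * sech2 z) + (4/3) * (th z * (sg z ^ Suc (Suc (Suc k)) * sech2 z)))"])
        (intro symb0_intros, cases k, simp_all add: ze_eq algebra_simps numeral_eq_Suc)
  qed (rule symb_grad_sech2_jet)
next
  case (symb_jet_logp k)
  show ?case
  proof (intro exI conjI)
    show "symb (0 + 3) (\<lambda>z. lam z ^ 3 * (xi z * (- (2/3) * real k * (sg z ^ k * logp z)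
        + (2/3) * (sg z ^ Suc (Suc k) * sech2 z))))"
      by (rule symb_factor[where m = 3, rotated]) (rule refl, simp, intro symb0_intros)
    show "symb (0 + 2) (\<lambda>z. lam z ^ 2 * (real k * (sg z ^ (k - 1) * logp z) - sg z ^ Suc k * sech2 z)
       + lam z ^ 2 * (lam z ^ 2 * (- (2/3) * real k * (sg z ^ Suc k * logp z) + (2/3) * (sg z ^ Suc (Suc (Suc k)) * sech2 z))))"
      (is "symb _ (\<lambda>z. lam z ^ 2 * ?A z + lam z ^ 2 * ?B z)")
      by (rule symb_factor[where m = 2 and h = "\<lambda>z. ?A z + ?B z"])
        (intro symb0_intros, simp_all add: distrib_left)
    show "symb (0 + 3) (\<lambda>z. ze z * (lam z ^ 2 * (real k * (sg z ^ (k - 1) * logp z) - sg z ^ Suc k * sech2 z)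
       + lam z ^ 2 * (lam z ^ 2 * (- (2/3) * real k * (sg z ^ Suc k * logp z) + (2/3) * (sg z ^ Suc (Suc (Suc k)) * sech2 z)))))"
      by (rule symb_factor[where m = 3 and h = "\<lambda>z. (real k * (sg z ^ k * logp z) - sg z ^ Suc (Suc k) * sech2 z)
       + lam z ^ 2 * (- (2/3) * real k * (sg z ^ Suc (Suc k) * logp z) + (2/3) * (sg z ^ Suc (Suc (Suc (Suc k))) * sech2 z))"])
        (intro symb0_intros, cases k, simp_all add: ze_eq algebra_simps numeral_eq_Suc)
  qed (rule symb_grad_logp_jet)
next
  case (symb_add n f g)
  then obtain fx fy gx gy where *: "has_grad f fx fy" "has_grad g gx gy"
    "symb (n + 3) fx" "symb (n + 3) gx" "symb (n + 2) fy" "symb (n + 2) gy"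
    "symb (n + 3) (\<lambda>z. ze z * fy z)" "symb (n + 3) (\<lambda>z. ze z * gy z)" by blast
  show ?case
  proof (intro exI conjI)
    show "has_grad (\<lambda>z. f z + g z) (\<lambda>z. fx z + gx z) (\<lambda>z. fy z + gy z)"
      by (rule has_grad_add[OF *(1,2)])
    show "symb (n + 3) (\<lambda>z. ze z * (fy z + gy z))"
      unfolding distrib_left by (intro symb.symb_add *)
  qed (intro symb.symb_add *)+
next
  case (symb_mult m f n g)
  then obtain fx fy gx gy where *: "has_grad f fx fy" "has_grad g gx gy"
    "symb (m + 3) fx" "symb (n + 3) gx" "symb (m + 2) fy" "symb (n + 2) gy"
    "symb (m + 3) (\<lambda>z. ze z * fy z)" "symb (n + 3) (\<lambda>z. ze z * gy z)" by blast
  note fg = symb_mult.hyps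
  show ?case
  proof (intro exI conjI)
    show "symb (m + n + 3) (\<lambda>z. fx z * g z + f z * gx z)"
      using symb.symb_mult[OF *(3) fg(2)] symb.symb_mult[OF fg(1) *(4)]
      by (auto intro!: symb.symb_add simp: add_ac)
    show "symb (m + n + 2) (\<lambda>z. fy z * g z + f z * gy z)"
      using symb.symb_mult[OF *(5) fg(2)] symb.symb_mult[OF fg(1) *(6)]
      by (auto intro!: symb.symb_add simp: add_ac)
    have "symb (m + n + 3) (\<lambda>z. ze z * fy z * g z + f z * (ze z * gy z))"
      using symb.symb_mult[OF *(7) fg(2)] symb.symb_mult[OF fg(1) *(8)]
      by (auto intro!: symb.symb_add simp: add_ac)
    then show "symb (m + n + 3) (\<lambda>z. ze z * (fy z * g z + f z * gy z))"
      by (rule symb_cong) (simp add: algebra_simps)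
  qed (rule has_grad_mult[OF *(1,2)])
next
  case (symb_weaken n f)
  then show ?case by (metis add_Suc symb.symb_weaken)
qed

lemma
  assumes "symb n g"
  shows symb_has_grad: "has_grad g (dx g) (dy g)"
    and symb_dx: "symb (n + 3) (dx g)"
    and symb_dy: "symb (n + 2) (dy g)"
    and symb_ze_dy: "symb (n + 3) (\<lambda>z. ze z * dy g z)"
  using symb_grad[OF assms] has_grad_dx has_grad_dy by auto

text \<open>The profiles decay exponentially in \<open>sg\<close>, so their products with powers of \<open>sg\<close> are bounded.\<close>

lemma power_le_fact_exp:
  assumes "(0::real) \<le> s" shows "s ^ k \<le> fact k * exp s"
proof -
  have "s ^ k /\<^sub>R fact k \<le> (\<Sum>n. s ^ n /\<^sub>R fact n)"
    using sum_le_suminf[OF summable_exp_generic[of s], of "{k}"] assms by simp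
  then have "s ^ k / fact k \<le> exp s" by (simp add: exp_def field_simps)
  then show ?thesis by (simp add: field_simps)
qed

lemma sech2_le: "0 \<le> 1 - tanh s ^ 2" "1 - tanh s ^ 2 \<le> 4 * exp (- (2 * \<bar>s\<bar>))" for s :: real
proof -
  have c: "cosh s = cosh \<bar>s\<bar>" by simp
  have "1 - tanh s ^ 2 = (cosh s ^ 2 - sinh s ^ 2) / cosh s ^ 2"
    by (simp add: tanh_def power_divide diff_divide_distrib)
  then have e: "1 - tanh s ^ 2 = 1 / cosh s ^ 2"
    using cosh_square_eq[of s] by simp
  then show "0 \<le> 1 - tanh s ^ 2" by simp
  have "exp \<bar>s\<bar> / 2 \<le> cosh s" unfolding c by (simp add: cosh_field_def)
  then have "(exp \<bar>s\<bar> / 2) ^ 2 \<le> cosh s ^ 2" by (intro power_mono) auto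
  then have "1 / cosh s ^ 2 \<le> 1 / (exp \<bar>s\<bar> / 2) ^ 2"
    by (intro divide_left_mono) auto
  also have "\<dots> = 4 * exp (- (2 * \<bar>s\<bar>))"
    by (simp add: power_divide exp_minus field_simps power2_eq_square flip: exp_add)
  finally show "1 - tanh s ^ 2 \<le> 4 * exp (- (2 * \<bar>s\<bar>))" unfolding e .
qed

lemma log_profile_bounds:
  fixes s :: real
  shows "\<bar>ln (2 * cosh s) - s * tanh s\<bar> \<le> (1 + 2 * \<bar>s\<bar>) * exp (- (2 * \<bar>s\<bar>))"
proof -
  let ?a = "\<bar>s\<bar>" and ?e = "exp (- (2 * \<bar>s\<bar>))"
  have st: "s * tanh s = ?a * tanh ?a" by (cases "s \<ge> 0") auto
  have "2 * cosh s = exp ?a * (1 + ?e)"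
    by (subst cosh_real_abs[symmetric]) (simp add: cosh_field_def algebra_simps flip: exp_add)
  then have ln: "ln (2 * cosh s) = ?a + ln (1 + ?e)"
    using add_pos_pos[OF zero_less_one exp_gt_zero[of "- (2 * ?a)"]] by (simp add: ln_mult)
  have t: "1 - tanh ?a \<le> 2 * ?e"
  proof -
    have "1 - (1 - e) / (1 + e) \<le> 2 * e" if "0 < e" for e :: real
      using that by (simp add: field_simps)
    then show ?thesis unfolding tanh_real_altdef by simp
  qed
  have "0 \<le> ?a * (1 - tanh ?a)"
    using tanh_real_lt_1[of ?a] by (intro mult_nonneg_nonneg) auto
  moreover have "?a * (1 - tanh ?a) \<le> ?a * (2 * ?e)"
    by (intro mult_left_mono t) auto
  moreover have "0 \<le> ln (1 + ?e)" "ln (1 + ?e) \<le> ?e"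
    by (auto intro!: ln_add_one_self_le_self)
  ultimately have "\<bar>?a + ln (1 + ?e) - ?a * tanh ?a\<bar> \<le> ?e + ?a * (2 * ?e)"
    unfolding right_diff_distrib by linarith
  also have "\<dots> = (1 + 2 * ?a) * ?e" by (simp add: algebra_simps)
  finally show ?thesis unfolding ln st .
qed

lemma bounded_jet_sech2: "\<exists>C. \<forall>z. \<bar>sg z ^ k * sech2 z\<bar> \<le> C"
proof (intro exI allI)
  fix z
  have "\<bar>sg z ^ k * sech2 z\<bar> = \<bar>sg z\<bar> ^ k * sech2 z"
    using sech2_le(1)[of "sg z"] by (simp add: sech2_def th_def abs_mult power_abs)
  also have "\<dots> \<le> (fact k * exp \<bar>sg z\<bar>) * (4 * exp (- (2 * \<bar>sg z\<bar>)))"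
    using sech2_le[of "sg z"] unfolding sech2_def th_def
    by (intro mult_mono power_le_fact_exp) auto
  also have "\<dots> = 4 * fact k * exp (- \<bar>sg z\<bar>)" by (simp flip: exp_add)
  also have "\<dots> \<le> 4 * fact k" by simp
  finally show "\<bar>sg z ^ k * sech2 z\<bar> \<le> 4 * fact k" .
qed

lemma bounded_jet_logp: "\<exists>C. \<forall>z. \<bar>sg z ^ k * logp z\<bar> \<le> C"
proof (intro exI allI)
  fix z
  let ?a = "\<bar>sg z\<bar>"
  have "\<bar>sg z ^ k * logp z\<bar> \<le> ?a ^ k * ((1 + 2 * ?a) * exp (- (2 * ?a)))"
    using log_profile_bounds[of "sg z"] unfolding logp_def
    by (simp add: abs_mult power_abs mult_left_mono)
  also have "\<dots> = (?a ^ k + 2 * ?a ^ Suc k) * exp (- (2 * ?a))"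
    by (simp add: algebra_simps)
  also have "\<dots> \<le> (fact k * exp ?a + 2 * (fact (Suc k) * exp ?a)) * exp (- (2 * ?a))"
    by (intro mult_right_mono add_mono mult_left_mono power_le_fact_exp) auto
  also have "\<dots> = (fact k + 2 * fact (Suc k)) * exp (- ?a)"
    by (simp add: algebra_simps flip: exp_add)
  also have "\<dots> \<le> fact k + 2 * fact (Suc k)"
    by (rule mult_right_le_one_le) auto
  finally show "\<bar>sg z ^ k * logp z\<bar> \<le> fact k + 2 * fact (Suc k)" .
qed

lemma lam_le_1: "lam z \<le> 1"
proof -
  have "lam z ^ 6 \<le> 1 ^ 6"
    using unit_sphere[of z] by (smt (verit) power_one zero_le_power2)
  then show ?thesis using lam_pos[of z] by (simp add: power_le_one_iff)
qed

lemma abs_xi_le_1: "\<bar>xi z\<bar> \<le> 1" and abs_ze_le_1: "\<bar>ze z\<bar> \<le> 1"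
proof -
  have "lam z ^ 6 \<ge> 0" using lam_pos[of z] by simp
  then have "xi z ^ 2 \<le> 1" "ze z ^ 2 \<le> 1"
    using unit_sphere[of z] by (smt (verit) zero_le_power2)+
  then show "\<bar>xi z\<bar> \<le> 1" "\<bar>ze z\<bar> \<le> 1"
    by (simp_all add: abs_square_le_1)
qed

lemma symb_bound: "symb n g \<Longrightarrow> \<exists>C. \<forall>z. \<bar>g z\<bar> \<le> C * lam z ^ n"
proof (induction rule: symb.induct)
  case symb_lam
  show ?case using lam_pos by (intro exI[of _ 1]) (simp add: less_imp_le)
next
  case (symb_add n f g)
  then obtain C D where "\<bar>f z\<bar> \<le> C * lam z ^ n" "\<bar>g z\<bar> \<le> D * lam z ^ n" for z by blast
  then have "\<bar>f z + g z\<bar> \<le> (C + D) * lam z ^ n" for z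
    by (smt (verit) distrib_right)
  then show ?case by blast
next
  case (symb_mult m f n g)
  then obtain C D where *: "\<bar>f z\<bar> \<le> C * lam z ^ m" "\<bar>g z\<bar> \<le> D * lam z ^ n" for z by blast
  have "\<bar>f z * g z\<bar> \<le> (C * lam z ^ m) * (D * lam z ^ n)" for z
    unfolding abs_mult using *[of z] by (intro mult_mono) (auto intro: order_trans[OF abs_ge_zero])
  then have "\<bar>f z * g z\<bar> \<le> (C * D) * lam z ^ (m + n)" for z
    by (simp add: power_add mult_ac)
  then show ?case by blast
next
  case (symb_weaken n f)
  then obtain C where *: "\<bar>f z\<bar> \<le> C * lam z ^ Suc n" for z by blast
  have "\<bar>f z\<bar> \<le> \<bar>C\<bar> * lam z ^ n" for z
  proof -
    have "lam z ^ Suc n \<le> lam z ^ n"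
      using lam_pos[of z] lam_le_1[of z] by (intro power_decreasing) auto
    then have "C * lam z ^ Suc n \<le> \<bar>C\<bar> * lam z ^ n"
      using lam_pos[of z] by (intro mult_mono) auto
    then show ?thesis using *[of z] by linarith
  qed
  then show ?case by blast
next
  case symb_th
  show ?case using tanh_real_bounds[of "sg _"]
    by (intro exI[of _ 1]) (auto simp: th_def abs_le_iff less_imp_le intro!: less_imp_le)
qed (use abs_xi_le_1 abs_ze_le_1 bounded_jet_sech2 bounded_jet_logp in auto)

section \<open>Equality of mixed partial derivatives\<close>

text \<open>
  \<open>mixed f\<close>: the function \<open>f\<close> has a gradient, whose components have gradients, and the two mixed second
  derivatives agree.  This form of Schwarz's theorem is immediate for functions built from the coordinates
  by sums, products and composition.
\<close>

definition mixed :: "(real \<times> real \<Rightarrow> real) \<Rightarrow> bool" where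
  "mixed f \<longleftrightarrow> (\<exists>fx fy fxx fxy fyy. has_grad f fx fy \<and> has_grad fx fxx fxy \<and> has_grad fy fxy fyy)"

lemma mixed_commute: "mixed f \<Longrightarrow> dy (dx f) = dx (dy f)"
  unfolding mixed_def by (metis has_grad_dx has_grad_dy)

lemma mixed_const: "mixed (\<lambda>_. c)" and mixed_fst: "mixed fst" and mixed_snd: "mixed snd"
  unfolding mixed_def using has_grad_const has_grad_fst has_grad_snd by blast+

lemma mixed_add: "mixed f \<Longrightarrow> mixed g \<Longrightarrow> mixed (\<lambda>z. f z + g z)"
  unfolding mixed_def by (elim exE conjE, intro exI conjI, (rule has_grad_add, assumption+)+)

lemma mixed_mult:
  assumes "mixed f" "mixed g" shows "mixed (\<lambda>z. f z * g z)"
proof -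
  obtain fx fy fxx fxy fyy where f: "has_grad f fx fy" "has_grad fx fxx fxy" "has_grad fy fxy fyy"
    using assms(1) unfolding mixed_def by blast
  obtain gx gy gxx gxy gyy where g: "has_grad g gx gy" "has_grad gx gxx gxy" "has_grad gy gxy gyy"
    using assms(2) unfolding mixed_def by blast
  have "has_grad (\<lambda>z. fx z * g z + f z * gx z)
      (\<lambda>z. fxx z * g z + fx z * gx z + (fx z * gx z + f z * gxx z))
      (\<lambda>z. fxy z * g z + fx z * gy z + (fy z * gx z + f z * gxy z))"
    by (intro has_grad_add has_grad_mult f g)
  moreover have "has_grad (\<lambda>z. fy z * g z + f z * gy z)
      (\<lambda>z. fxy z * g z + fy z * gx z + (fx z * gy z + f z * gxy z))
      (\<lambda>z. fyy z * g z + fy z * gy z + (fy z * gy z + f z * gyy z))"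
    by (intro has_grad_add has_grad_mult f g)
  then have "has_grad (\<lambda>z. fy z * g z + f z * gy z)
      (\<lambda>z. fxy z * g z + fx z * gy z + (fy z * gx z + f z * gxy z))
      (\<lambda>z. fyy z * g z + fy z * gy z + (fy z * gy z + f z * gyy z))"
    by (rule has_grad_cong) auto
  ultimately show ?thesis
    unfolding mixed_def using has_grad_mult[OF f(1) g(1)] by blast
qed

lemma mixed_comp:
  assumes "mixed f" "\<And>z. (h has_field_derivative h' (f z)) (at (f z))"
    "\<And>z. (h' has_field_derivative h'' (f z)) (at (f z))"
  shows "mixed (\<lambda>z. h (f z))"
proof -
  obtain fx fy fxx fxy fyy where f: "has_grad f fx fy" "has_grad fx fxx fxy" "has_grad fy fxy fyy"
    using assms(1) unfolding mixed_def by blast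
  have h: "has_grad (\<lambda>z. h (f z)) (\<lambda>z. h' (f z) * fx z) (\<lambda>z. h' (f z) * fy z)"
    and h': "has_grad (\<lambda>z. h' (f z)) (\<lambda>z. h'' (f z) * fx z) (\<lambda>z. h'' (f z) * fy z)"
    by (rule has_grad_comp[OF f(1)] assms)+
  have "has_grad (\<lambda>z. h' (f z) * fx z)
      (\<lambda>z. h'' (f z) * fx z * fx z + h' (f z) * fxx z)
      (\<lambda>z. h'' (f z) * fy z * fx z + h' (f z) * fxy z)"
    by (intro has_grad_mult h' f)
  moreover have "has_grad (\<lambda>z. h' (f z) * fy z)
      (\<lambda>z. h'' (f z) * fx z * fy z + h' (f z) * fxy z)
      (\<lambda>z. h'' (f z) * fy z * fy z + h' (f z) * fyy z)"
    by (intro has_grad_mult h' f)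
  then have "has_grad (\<lambda>z. h' (f z) * fy z)
      (\<lambda>z. h'' (f z) * fy z * fx z + h' (f z) * fxy z)
      (\<lambda>z. h'' (f z) * fy z * fy z + h' (f z) * fyy z)"
    by (rule has_grad_cong) auto
  ultimately show ?thesis unfolding mixed_def using h by blast
qed

lemma mixed_power: "mixed f \<Longrightarrow> mixed (\<lambda>z. f z ^ n)"
  by (induction n) (simp_all add: mixed_const mixed_mult)

lemma mixed_lam: "mixed lam"
proof -
  have "mixed (\<lambda>z. (1 + fst z ^ 2 + snd z ^ 2) powr (- 1 / 6))"
    by (rule mixed_comp[where h' = "\<lambda>q. (- 1 / 6) * q powr (- 1 / 6 - 1)"
          and h'' = "\<lambda>q. (- 1 / 6) * ((- 1 / 6 - 1) * q powr (- 1 / 6 - 1 - 1))"])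
      (intro mixed_add mixed_power mixed_fst mixed_snd mixed_const DERIV_cmult
        has_real_derivative_powr one_plus_pos)+
  then show ?thesis by (simp add: lam_def[abs_def])
qed

lemma mixed_xi: "mixed xi"
  using mixed_mult[OF mixed_fst mixed_power[OF mixed_lam, of 3]] by (simp add: xi_def[abs_def])

lemma mixed_sg: "mixed sg"
  using mixed_mult[OF mixed_snd mixed_power[OF mixed_lam, of 2]] by (simp add: sg_def[abs_def])

lemma mixed_th: "mixed th"
proof -
  have "mixed (\<lambda>z. tanh (sg z))"
    by (rule mixed_comp[OF mixed_sg, where h' = "\<lambda>s. 1 - tanh s ^ 2"
          and h'' = "\<lambda>s. - 2 * tanh s * (1 - tanh s ^ 2)"]) (auto intro!: derivative_eq_intros)
  then show ?thesis by (simp add: th_def[abs_def])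
qed

lemma mixed_sech2: "mixed sech2"
  using mixed_add[OF mixed_const[of 1] mixed_mult[OF mixed_const[of "-1"] mixed_power[OF mixed_th, of 2]]]
  by (simp add: sech2_def[abs_def])

lemma mixed_logp: "mixed logp"
proof -
  have "mixed (\<lambda>z. ln (2 * cosh (sg z)) - sg z * tanh (sg z))"
    by (rule mixed_comp[OF mixed_sg, where h' = "\<lambda>s. - s * (1 - tanh s ^ 2)"
          and h'' = "\<lambda>s. - (1 - tanh s ^ 2) + 2 * s * tanh s * (1 - tanh s ^ 2)"])
      (auto intro!: derivative_eq_intros simp: tanh_def field_simps power2_eq_square)
  then show ?thesis by (simp add: logp_def[abs_def])
qed

section \<open>The jet, its pressure and its force\<close>

text \<open>
  The velocity \<open>(vel1, vel2)\<close> is \<open>(\<psi>\<^sub>y, - \<psi>\<^sub>x)\<close> for \<open>\<psi> = 3 lam\<^sup>-\<^sup>1 (1 + xi) th\<close>, written out so that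
  its orders \<open>1\<close> and \<open>2\<close> are visible.  The leading term of \<open>vel1\<close> is confined to the jet, whereas
  \<open>vel2\<close> is of order \<open>2\<close> outside it too, because of the fluid that the jet draws in.
\<close>

definition amp1 :: "real \<times> real \<Rightarrow> real" where
  "amp1 z = (1 - 2 * xi z) * th z - 2 * (1 + xi z) * (sg z * sech2 z)"

definition amp2 :: "real \<times> real \<Rightarrow> real" where
  "amp2 z = - ((1 + xi z) * ((3 - 2 * xi z) * th z - 2 * xi z * (sg z * sech2 z)))"

definition vel1 :: "real \<times> real \<Rightarrow> real" where
  "vel1 z = 3 * (lam z * ((1 + xi z) * sech2 z)) + lam z ^ 2 * (ze z * amp1 z)"

definition vel2 :: "real \<times> real \<Rightarrow> real" where
  "vel2 z = lam z ^ 2 * amp2 z"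

text \<open>
  The function \<open>q\<close> of the pressure \<open>v\<^sub>y - v\<^sup>2 + q\<^sub>x\<close>.  The polynomial in \<open>xi\<close> solves \<open>q\<^sub>y = - u v\<close>
  exactly for the flow with \<open>th\<close> replaced by \<open>1\<close> or \<open>- 1\<close>, which is the flow away from the jet; it is even
  in \<open>y\<close> and thus serves both sides.  The last summand integrates the leading part of \<open>- u v\<close> across the
  jet, with the constant of integration chosen to make it decay.
\<close>

definition pot :: "real \<times> real \<Rightarrow> real" where
  "pot z = lam z * (- 9 + (15/4) * xi z + (12/7) * xi z ^ 2 - (6/5) * xi z ^ 3
     + (1 + xi z) * (- 5 * sech2 z + 8 * logp z - 4 * th z * (sg z * sech2 z)))"

definition pres :: "real \<times> real \<Rightarrow> real" where
  "pres z = dy vel2 z - vel2 z ^ 2 + dx pot z"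

text \<open>The force in the jet direction and across, defined by the momentum equations.\<close>

definition force1 :: "real \<times> real \<Rightarrow> real" where
  "force1 z = dx (dx vel1) z + dy (dy vel1) z - dx pres z - (vel1 z * dx vel1 z + vel2 z * dy vel1 z)"

definition force2 :: "real \<times> real \<Rightarrow> real" where
  "force2 z = dx (dx vel2) z + dy (dy vel2) z - dy pres z - (vel1 z * dx vel2 z + vel2 z * dy vel2 z)"

lemma symb_amp1: "symb 0 amp1"
  unfolding amp1_def[abs_def] by (intro symb0_intros)

lemma symb_amp2: "symb 0 amp2"
  unfolding amp2_def[abs_def] by (intro symb0_intros)

lemma symb_vel1: "symb 1 vel1"
  by (rule symb_factor[where m = 1 and h = "\<lambda>z. 3 * ((1 + xi z) * sech2 z) + lam z * (ze z * amp1 z)"])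
    (intro symb0_intros symb_amp1, simp_all add: vel1_def power2_eq_square algebra_simps)

lemma symb_vel2: "symb 2 vel2"
  by (rule symb_factor[where m = 2, OF symb_amp2]) (simp_all add: vel2_def)

lemma symb_pot: "symb 1 pot"
  unfolding pot_def[abs_def]
  by (rule symb_factor[where m = 1, rotated]) (simp only: power_one_right, simp, intro symb0_intros)

lemma symb_pres: "symb 4 pres"
  using symb_dy[OF symb_vel2] symb_pow[OF symb_vel2, of 2] symb_dx[OF symb_pot]
  unfolding pres_def[abs_def] by (intro symb_add symb_diff) simp_all

lemma
  assumes "has_grad g gx gy"
  shows dx_eqI: "gx z = c \<Longrightarrow> dx g z = c" and dy_eqI: "gy z = c \<Longrightarrow> dy g z = c"
  using has_grad_dx[OF assms] has_grad_dy[OF assms] by auto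

text \<open>
  Rewriting with these relations, in addition to commutative ring normalisation, decides identities
  between polynomials in the generators.
\<close>

lemma xi_xi: "xi z * xi z = 1 - lam z ^ 6 - lam z ^ 2 * sg z ^ 2"
  using unit_sphere[of z] unfolding ze_eq by (simp add: power2_eq_square algebra_simps)

lemma xi_xi': "xi z * (xi z * a) = (1 - lam z ^ 6 - lam z ^ 2 * sg z ^ 2) * a"
  using xi_xi[of z] by (simp flip: mult.assoc)

lemma th_th: "th z * th z = 1 - sech2 z" "th z * (th z * a) = (1 - sech2 z) * a"
  using th_eq[of z] by (simp_all add: power2_eq_square flip: mult.assoc)

lemma numeral_minus_one: "(2::nat) - 1 = 1" "(3::nat) - 1 = 2" "(4::nat) - 1 = 3"
  by simp_all

lemmas exponent_simps = of_nat_numeral numeral_minus_one power_one_right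

lemmas ring_normal_form = ze_eq xi_xi xi_xi' th_th algebra_simps add_divide_distrib diff_divide_distrib numeral_eq_Suc

lemma div_free: "dy vel2 z = - dx vel1 z"
  unfolding vel2_def[abs_def] amp2_def vel1_def[abs_def] amp1_def
  by (rule dy_eqI, (rule grad)+, rule equation_minus_iff[THEN iffD2], rule dx_eqI, (rule grad)+)
    (simp add: ring_normal_form)

lemma mixed_vel2: "mixed vel2"
proof -
  have "mixed (\<lambda>z. lam z ^ 2 * ((-1) * ((1 + xi z) * ((3 + (- 2) * xi z) * th z + (- 2) * (xi z * (sg z * sech2 z))))))"
    by (intro mixed_add mixed_mult mixed_power mixed_const mixed_lam mixed_xi mixed_sg mixed_th mixed_sech2)
  then show ?thesis by (simp add: vel2_def[abs_def] amp2_def algebra_simps)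
qed

lemma mixed_pot: "mixed pot"
proof -
  have "mixed (\<lambda>z. lam z * (- 9 + (15/4) * xi z + (12/7) * xi z ^ 2 + (- 6/5) * xi z ^ 3
     + (1 + xi z) * ((- 5) * sech2 z + 8 * logp z + (- 4) * (th z * (sg z * sech2 z)))))"
    by (intro mixed_add mixed_mult mixed_power mixed_const mixed_lam mixed_xi mixed_sg mixed_th mixed_sech2 mixed_logp)
  then show ?thesis by (simp add: pot_def[abs_def] algebra_simps)
qed

lemma dx_add: "symb m f \<Longrightarrow> symb n g \<Longrightarrow> dx (\<lambda>z. f z + g z) z = dx f z + dx g z"
  and dy_add: "symb m f \<Longrightarrow> symb n g \<Longrightarrow> dy (\<lambda>z. f z + g z) z = dy f z + dy g z"
  and dx_diff: "symb m f \<Longrightarrow> symb n g \<Longrightarrow> dx (\<lambda>z. f z - g z) z = dx f z - dx g z"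
  and dy_diff: "symb m f \<Longrightarrow> symb n g \<Longrightarrow> dy (\<lambda>z. f z - g z) z = dy f z - dy g z"
  and dx_mult: "symb m f \<Longrightarrow> symb n g \<Longrightarrow> dx (\<lambda>z. f z * g z) z = dx f z * g z + f z * dx g z"
  and dy_mult: "symb m f \<Longrightarrow> symb n g \<Longrightarrow> dy (\<lambda>z. f z * g z) z = dy f z * g z + f z * dy g z"
  by ((rule dx_eqI dy_eqI, (rule has_grad_add has_grad_diff has_grad_mult, erule symb_has_grad, erule symb_has_grad), rule refl)+)

text \<open>
  Leading parts: \<open>vel1\<^sup>2\<close> is \<open>lead_square\<close>, \<open>dy vel1\<close> is \<open>- lead_shear\<close>, and \<open>vel1 vel2\<close> is
  \<open>- lead_cross + outer_cross\<close>, up to remainders whose order is high enough to be differentiated crudely.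
  Inside the jet \<open>xi\<close> is \<open>1\<close> or \<open>- 1\<close> up to two orders, so \<open>(1 + xi)\<^sup>2\<close> may be replaced by
  \<open>2 (1 + xi)\<close>, and so may \<open>xi (1 + xi)\<^sup>2\<close>; hence the single factor \<open>1 + xi\<close> in all of them.
\<close>

definition lead_square :: "real \<times> real \<Rightarrow> real" where
  "lead_square z = 18 * (lam z ^ 2 * ((1 + xi z) * (sech2 z * sech2 z)))"

definition lead_cross :: "real \<times> real \<Rightarrow> real" where
  "lead_cross z = 6 * (lam z ^ 3 * ((1 + xi z) * (th z * sech2 z - 2 * (sech2 z * (sg z * sech2 z)))))"

definition lead_shear :: "real \<times> real \<Rightarrow> real" where
  "lead_shear z = 6 * (lam z ^ 3 * ((1 + xi z) * (th z * sech2 z)))"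

definition outer_cross :: "real \<times> real \<Rightarrow> real" where
  "outer_cross z = lam z ^ 4 * (ze z * (amp1 z * amp2 z))"

lemma symb_lead_shear: "symb 3 lead_shear"
  by (rule symb_factor[where m = 3 and h = "\<lambda>z. 6 * ((1 + xi z) * (th z * sech2 z))"])
    (intro symb0_intros, simp_all add: lead_shear_def)

lemma symb_lead_square: "symb 2 lead_square"
  by (rule symb_factor[where m = 2 and h = "\<lambda>z. 18 * ((1 + xi z) * (sech2 z * sech2 z))"])
    (intro symb0_intros, simp_all add: lead_square_def)

lemma symb_lead_cross: "symb 3 lead_cross"
  by (rule symb_factor[where m = 3 and h = "\<lambda>z. 6 * ((1 + xi z) * (th z * sech2 z - 2 * (sech2 z * (sg z * sech2 z))))"])
    (intro symb0_intros, simp_all add: lead_cross_def)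

lemma symb_outer_cross: "symb 4 outer_cross"
  by (rule symb_factor[where m = 4 and h = "\<lambda>z. ze z * (amp1 z * amp2 z)"])
    (intro symb0_intros symb_amp1 symb_amp2, simp_all add: outer_cross_def)

lemma one_minus_xi_sq: "1 - xi z ^ 2 = lam z ^ 2 * (lam z ^ 4 + sg z ^ 2)"
  using xi_xi[of z] by algebra

lemma vel1_sq_leading: "symb 4 (\<lambda>z. vel1 z * vel1 z - lead_square z)"
proof (rule symb_factor)
  show "symb 0 (\<lambda>z. - 9 * (lam z ^ 4 * (sech2 z * sech2 z) + sech2 z * (sg z ^ 2 * sech2 z))
        + 6 * ((1 + xi z) * ((sg z * sech2 z) * amp1 z)) + ze z ^ 2 * amp1 z ^ 2)"
    by (intro symb0_intros symb_amp1)
  fix z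
  have "vel1 z * vel1 z - lead_square z = - 9 * lam z ^ 2 * (1 - xi z ^ 2) * sech2 z ^ 2
      + 6 * lam z ^ 3 * (1 + xi z) * (ze z * sech2 z) * amp1 z + lam z ^ 4 * (ze z * amp1 z) ^ 2"
    unfolding vel1_def lead_square_def by algebra
  then show "vel1 z * vel1 z - lead_square z = lam z ^ 4 * (- 9 * (lam z ^ 4 * (sech2 z * sech2 z) + sech2 z * (sg z ^ 2 * sech2 z))
        + 6 * ((1 + xi z) * ((sg z * sech2 z) * amp1 z)) + ze z ^ 2 * amp1 z ^ 2)"
    unfolding one_minus_xi_sq ze_eq by algebra
qed simp

lemma vel1_vel2_leading: "symb 5 (\<lambda>z. vel1 z * vel2 z + lead_cross z - outer_cross z)"
proof (rule symb_factor)
  show "symb 0 (\<lambda>z. - 3 * ((lam z ^ 4 * sech2 z + sg z ^ 2 * sech2 z)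
        * ((1 + 2 * xi z) * th z + 2 * (2 + xi z) * (sg z * sech2 z))))"
    by (intro symb0_intros)
  fix z
  have "vel1 z * vel2 z + lead_cross z - outer_cross z = - 3 * lam z ^ 3 * sech2 z * (1 - xi z ^ 2)
        * ((1 + 2 * xi z) * th z + 2 * (2 + xi z) * (sg z * sech2 z))"
    unfolding vel1_def vel2_def amp2_def lead_cross_def outer_cross_def by algebra
  then show "vel1 z * vel2 z + lead_cross z - outer_cross z = lam z ^ 5 * (- 3 * ((lam z ^ 4 * sech2 z + sg z ^ 2 * sech2 z)
        * ((1 + 2 * xi z) * th z + 2 * (2 + xi z) * (sg z * sech2 z))))"
    unfolding one_minus_xi_sq by algebra
qed simp

lemma dy_vel1_leading: "symb 5 (\<lambda>z. dy vel1 z + lead_shear z)"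
proof -
  let ?h = "\<lambda>z. - ((1 + xi z) * (sg z * sech2 z)) - 3 * (xi z * (sg z * sech2 z)) + 4 * ((1 + xi z) * (th z * (sg z ^ 2 * sech2 z)))
        - (2/3) * (ze z ^ 2 * amp1 z) + (1 - ze z ^ 2) * amp1 z"
  have e1: "dy vel1 z + lead_shear z = lam z ^ 5 * ?h z + lam z ^ 2 * (ze z * dy amp1 z)" for z
  proof -
    have "dy vel1 z = - lead_shear z + (lam z ^ 5 * ?h z + lam z ^ 2 * (ze z * dy amp1 z))"
      unfolding vel1_def[abs_def] lead_shear_def
      by (rule dy_eqI, (rule grad symb_has_grad[OF symb_amp1])+) (simp only: exponent_simps ze_eq, algebra)
    then show ?thesis by simp
  qed
  have e2: "symb 5 (\<lambda>z. lam z ^ 5 * ?h z)"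
    by (rule symb_factor[where m = 5, rotated]) (rule refl, simp, intro symb0_intros symb_amp1)
  have e3: "symb 5 (\<lambda>z. lam z ^ 2 * (ze z * dy amp1 z))"
    using symb_lam_mult[OF symb_ze_dy[OF symb_amp1], of 2] by simp
  show ?thesis by (rule symb_cong[OF symb_add[OF e2 e3] e1])
qed

text \<open>
  The Bickley jet solves the boundary layer equation: the leading parts of \<open>u\<^sub>y\<^sub>y\<close>, \<open>- (u\<^sup>2)\<^sub>x\<close> and
  \<open>- (u v)\<^sub>y\<close>, each of order \<open>5\<close>, cancel.
\<close>

lemma bickley: "symb 7 (\<lambda>z. dy lead_cross z - dy lead_shear z - dx lead_square z)"
proof (rule symb_factor)
  let ?h = "\<lambda>z. (48 * (th z * (sg z * sech2 z)) - 30 * sech2 z) * (lam z ^ 4 * sech2 z + sg z ^ 2 * sech2 z)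
    + 4 * ((5 + 8 * xi z) * (sech2 z * (sg z ^ 2 * sech2 z))) - 32 * ((1 + xi z) * (th z * (sech2 z * (sg z ^ 3 * sech2 z))))"
  show "symb 0 ?h" by (intro symb0_intros)
  fix z
  have "dy (\<lambda>z. lead_cross z - lead_shear z) z = 12 * lam z ^ 3 * sech2 z ^ 2 * ((1/3) * lam z ^ 3 * ze z * sg z * (3 + 6 * xi z)
      - (1 + xi z) * sgy z * (1 - 4 * sg z * th z))"
    unfolding lead_cross_def[abs_def] lead_shear_def
    by (rule dy_eqI, (rule grad)+) (simp only: exponent_simps, algebra)
  moreover have "dx lead_square z = 18 * lam z ^ 5 * sech2 z ^ 2 * (1 - xi z ^ 2
      - (2/3) * xi z * (1 + xi z) * (1 - 4 * sg z * th z))"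
    unfolding lead_square_def[abs_def] by (rule dx_eqI, (rule grad)+) (simp only: exponent_simps, algebra)
  ultimately have "dy lead_cross z - dy lead_shear z - dx lead_square z = lam z ^ 5 * sech2 z ^ 2 * (
      12 * (lam z * ze z * sg z * (1 + 2 * xi z) + (2/3) * (1 + xi z) * lam z * ze z * sg z * (1 - 4 * sg z * th z))
      - (30 - 48 * sg z * th z) * (1 - xi z ^ 2))"
    unfolding dy_diff[OF symb_lead_cross symb_lead_shear] by algebra
  then show "dy lead_cross z - dy lead_shear z - dx lead_square z = lam z ^ 7 * ?h z"
    unfolding one_minus_xi_sq ze_eq by algebra
qed simp

text \<open>
  The part of \<open>u v\<close> outside the jet has order \<open>4\<close> only; its derivative in \<open>y\<close> still gains three orders
  thanks to the factor \<open>ze\<close>.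
\<close>

lemma dy_outer_cross: "symb 7 (dy outer_cross)"
proof -
  let ?h = "\<lambda>z. (1 - ze z ^ 2) * (amp1 z * amp2 z) - (4/3) * (ze z ^ 2 * (amp1 z * amp2 z))"
  have s: "symb 0 (\<lambda>z. amp1 z * amp2 z)" by (intro symb0_intros symb_amp1 symb_amp2)
  have e1: "dy outer_cross z = lam z ^ 7 * ?h z + lam z ^ 4 * (ze z * dy (\<lambda>z. amp1 z * amp2 z) z)" for z
    unfolding outer_cross_def[abs_def]
    by (rule dy_eqI, rule has_grad_mult, rule has_grad_power, rule has_grad_lam,
        rule has_grad_mult, rule has_grad_ze, rule symb_has_grad[OF s]) (simp only: exponent_simps, algebra)
  have e2: "symb 7 (\<lambda>z. lam z ^ 7 * ?h z)"
    by (rule symb_factor[where m = 7, rotated]) (rule refl, simp, intro symb0_intros symb_amp1 symb_amp2)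
  have e3: "symb 7 (\<lambda>z. lam z ^ 4 * (ze z * dy (\<lambda>z. amp1 z * amp2 z) z))"
    using symb_lam_mult[OF symb_ze_dy[OF s], of 4] by simp
  show ?thesis by (rule symb_cong[OF symb_add[OF e2 e3] e1])
qed

lemma dy_pot_leading: "symb 5 (\<lambda>z. dy pot z - lead_cross z + outer_cross z)"
proof (rule symb_factor)
  let ?h = "\<lambda>z. - (1/3) * ((1 + 4 * xi z) * (- 5 * (sg z * sech2 z) + 8 * (sg z ^ 1 * logp z) - 4 * (th z * (sg z ^ 2 * sech2 z))))
    - 4 * ((1 + xi z) * (th z * (sg z ^ 2 * sech2 z) - 2 * (sech2 z * (sg z ^ 3 * sech2 z))))
    + (1 + xi z) * ((3 - 2 * xi z) * ((1 - 2 * xi z) * (sg z * sech2 z))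
       + (6 + 4 * xi z - 8 * xi z ^ 2) * (th z * (sg z ^ 2 * sech2 z)) - 4 * (xi z * ((1 + xi z) * (sech2 z * (sg z ^ 3 * sech2 z)))))"
  show "symb 0 ?h" by (intro symb0_intros)
  fix z
  have t: "th z * th z = 1 - sech2 z" by (rule th_th)
  have "dy pot z = lam z ^ 4 * ze z * (1 + xi z) * (3 - 2 * xi z) * (1 - 2 * xi z)
      - (1/3) * lam z ^ 4 * ze z * (1 + 4 * xi z) * (- 5 * sech2 z + 8 * logp z - 4 * th z * (sg z * sech2 z))
      + lam z * (1 + xi z) * (6 * (th z * sech2 z) - 12 * (sg z * sech2 z ^ 2)) * sgy z"
    unfolding pot_def[abs_def]
    by (rule dy_eqI, (rule grad)+) (simp only: exponent_simps, use t in algebra)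
  moreover have "outer_cross z = - (lam z ^ 4 * ze z * (1 + xi z)) * ((3 - 2 * xi z) * (1 - 2 * xi z) * (1 - sech2 z)
      - (6 + 4 * xi z - 8 * xi z ^ 2) * (th z * (sg z * sech2 z)) + 4 * xi z * (1 + xi z) * (sg z * sech2 z) ^ 2)"
    unfolding outer_cross_def amp1_def amp2_def t[symmetric] by algebra
  ultimately show "dy pot z - lead_cross z + outer_cross z = lam z ^ 5 * ?h z"
    unfolding lead_cross_def ze_eq by algebra
qed simp

lemma symb_dy_pot_plus_cross: "symb 5 (\<lambda>z. dy pot z + vel1 z * vel2 z)"
  by (rule symb_cong[OF symb_add[OF dy_pot_leading vel1_vel2_leading]]) simp

lemma symb_flow:
  "symb 1 vel1" "symb 2 vel2" "symb 4 pres" "symb 4 (dx vel1)" "symb 3 (dy vel1)" "symb 5 (dx vel2)" "symb 4 (dy vel2)"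
  "symb 2 (\<lambda>z. vel1 z * vel1 z)" "symb 3 (\<lambda>z. vel1 z * vel2 z)" "symb 4 (\<lambda>z. vel2 z * vel2 z)"
  using symb_vel1 symb_vel2 symb_pres symb_dx[OF symb_vel1] symb_dy[OF symb_vel1] symb_dx[OF symb_vel2] symb_dy[OF symb_vel2]
    symb_mult[OF symb_vel1 symb_vel1] symb_mult[OF symb_vel1 symb_vel2] symb_mult[OF symb_vel2 symb_vel2]
  by (simp_all add: eval_nat_numeral)

lemma symb_force2: "symb 8 force2"
proof -
  note vel2 = symb_flow(2,7,6) and uv = symb_flow(9) and vvsq = symb_flow(10)
  have Zy: "symb 3 (dy pot)" and Zx: "symb 4 (dx pot)"
    using symb_dy[OF symb_pot] symb_dx[OF symb_pot] by (simp_all add: eval_nat_numeral)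
  have "dy pres z = dy (dy vel2) z - 2 * vel2 z * dy vel2 z + dx (dy pot) z" for z
  proof -
    have pres: "pres = (\<lambda>z. dy vel2 z - vel2 z * vel2 z + dx pot z)"
      by (simp add: pres_def fun_eq_iff power2_eq_square)
    have "dy pres z = dy (dy vel2) z - (dy vel2 z * vel2 z + vel2 z * dy vel2 z) + dy (dx pot) z"
      unfolding pres dy_add[OF symb_diff[OF vel2(2) vvsq] Zx] dy_diff[OF vel2(2) vvsq] dy_mult[OF vel2(1) vel2(1)] ..
    then show ?thesis using mixed_commute[OF mixed_pot] by simp
  qed
  then have e: "force2 z = dx (dx vel2) z - dx (\<lambda>z. dy pot z + vel1 z * vel2 z) z" for z
    unfolding force2_def dx_add[OF Zy uv] dx_mult[OF symb_vel1 symb_vel2]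
    by (simp add: div_free algebra_simps)
  have "symb 8 (dx (dx vel2))" "symb 8 (dx (\<lambda>z. dy pot z + vel1 z * vel2 z))"
    using symb_dx[OF vel2(3)] symb_dx[OF symb_dy_pot_plus_cross] by simp_all
  then show ?thesis by (rule symb_cong[OF symb_diff e])
qed

lemma symb_force1: "symb 7 force1"
proof -
  note vel1 = symb_flow(1,5,4) and usq = symb_flow(8) and uv = symb_flow(9)
  have a: "symb 7 (dy (\<lambda>z. dy vel1 z + lead_shear z))" "symb 7 (dx (\<lambda>z. vel1 z * vel1 z - lead_square z))"
    "symb 7 (dy (\<lambda>z. vel1 z * vel2 z + lead_cross z - outer_cross z))"
    using symb_dy[OF dy_vel1_leading] symb_dx[OF vel1_sq_leading] symb_dy[OF vel1_vel2_leading] by simp_all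
  have uvC: "symb 3 (\<lambda>z. vel1 z * vel2 z + lead_cross z)" by (rule symb_add[OF uv symb_lead_cross])
  \<comment> \<open>The momentum equation in divergence form, with the leading parts split off and collected at the end.\<close>
  have e: "force1 z = dx (dx vel1) z - dx pres z + (dy (\<lambda>z. dy vel1 z + lead_shear z) z - dx (\<lambda>z. vel1 z * vel1 z - lead_square z) z
      - dy (\<lambda>z. vel1 z * vel2 z + lead_cross z - outer_cross z) z - dy outer_cross z + (dy lead_cross z - dy lead_shear z - dx lead_square z))" for z
    unfolding force1_def dy_add[OF vel1(2) symb_lead_shear] dx_diff[OF usq symb_lead_square] dy_diff[OF uvC symb_outer_cross]
      dy_add[OF uv symb_lead_cross] dx_mult[OF symb_vel1 symb_vel1] dy_mult[OF symb_vel1 symb_vel2]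
    by (simp add: div_free algebra_simps)
  have b: "symb 7 (dx (dx vel1))" "symb 7 (dx pres)"
    using symb_dx[OF vel1(3)] symb_dx[OF symb_pres] by simp_all
  show ?thesis
    by (rule symb_cong[OF symb_add[OF symb_diff[OF b]
          symb_add[OF symb_diff[OF symb_diff[OF symb_diff[OF a(1,2)] a(3)] dy_outer_cross] bickley]] e])
qed

section \<open>The stress and its symmetries\<close>

text \<open>
  The entries of the stress in jet coordinates; its divergence is the force.  Only the first component of
  that divergence is needed, since the second component of the force is odd in \<open>y\<close>.
\<close>

definition stress11 :: "real \<times> real \<Rightarrow> real" where
  "stress11 z = 2 * dx vel1 z - pres z - vel1 z * vel1 z"

definition stress12 :: "real \<times> real \<Rightarrow> real" where
  "stress12 z = dy vel1 z + dx vel2 z - vel1 z * vel2 z"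

definition stress22 :: "real \<times> real \<Rightarrow> real" where
  "stress22 z = 2 * dy vel2 z - pres z - vel2 z * vel2 z"

lemma symb_stress11: "symb 0 stress11" and symb_stress12: "symb 0 stress12" and symb_stress22: "symb 0 stress22"
  unfolding stress11_def[abs_def] stress12_def[abs_def] stress22_def[abs_def]
  by (intro symb_add symb_diff symb_cmult symb_flow[THEN symb_mono[rotated]]; simp)+

lemma force1_div: "force1 z = dx stress11 z + dy stress12 z"
proof -
  have "dx stress11 z = (0 * dx vel1 z + 2 * dx (dx vel1) z) - dx pres z - (dx vel1 z * vel1 z + vel1 z * dx vel1 z)"
    unfolding stress11_def[abs_def]
    by (rule dx_eqI, (rule has_grad_diff has_grad_mult has_grad_const symb_flow[THEN symb_has_grad])+) simp
  moreover have "dy stress12 z = dy (dy vel1) z + dy (dx vel2) z - (dy vel1 z * vel2 z + vel1 z * dy vel2 z)"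
    unfolding stress12_def[abs_def]
    by (rule dy_eqI, (rule has_grad_diff has_grad_add has_grad_mult symb_flow[THEN symb_has_grad])+) simp
  moreover have "dy (dx vel2) z = - dx (dx vel1) z"
  proof -
    have "dy (dx vel2) z = dx (dy vel2) z" using mixed_commute[OF mixed_vel2] by simp
    also have "\<dots> = dx (\<lambda>z. - dx vel1 z) z" by (simp add: div_free[abs_def] flip: fun_eq_iff)
    also have "\<dots> = - dx (dx vel1) z"
      by (rule dx_eqI, rule has_grad_minus, rule symb_flow[THEN symb_has_grad]) simp
    finally show ?thesis .
  qed
  ultimately show ?thesis
    unfolding force1_def by (simp add: div_free algebra_simps)
qed

text \<open>
  \<open>parity 1 g\<close> and \<open>parity (- 1) g\<close> say that \<open>g\<close> is even, respectively odd, in \<open>y\<close>.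
\<close>

definition parity :: "real \<Rightarrow> (real \<times> real \<Rightarrow> real) \<Rightarrow> bool" where
  "parity c g \<longleftrightarrow> (\<forall>x y. g (x, - y) = c * g (x, y))"

lemma
  assumes "parity c g" "has_grad g gx gy"
  shows parity_dx: "parity c (dx g)" and parity_dy: "parity (- c) (dy g)"
proof -
  have gx: "gx = dx g" and gy: "gy = dy g" using has_grad_dx has_grad_dy assms(2) by auto
  have "gx (x, - y) = c * gx (x, y) \<and> gy (x, - y) = - c * gy (x, y)" for x y
  proof -
    have "((\<lambda>z. (fst z, - snd z)) has_derivative (\<lambda>h. (fst h, - snd h))) (at (x, y))"
      by (auto intro!: derivative_eq_intros)
    moreover have "(g has_derivative (\<lambda>h. gx (x, - y) * fst h + gy (x, - y) * snd h))
        (at ((\<lambda>z. (fst z, - snd z)) (x, y)))"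
      using assms(2) by (simp add: has_grad_def)
    ultimately have A: "((\<lambda>z. g (fst z, - snd z)) has_derivative
        (\<lambda>h. gx (x, - y) * fst (fst h, - snd h) + gy (x, - y) * snd (fst h, - snd h))) (at (x, y))"
      by (rule has_derivative_compose)
    have B: "(\<lambda>z. g (fst z, - snd z)) = (\<lambda>z. c * g z)"
      using assms(1) by (auto simp: parity_def)
    have C: "((\<lambda>z. c * g z) has_derivative (\<lambda>h. c * (gx (x, y) * fst h + gy (x, y) * snd h))) (at (x, y))"
      using assms(2) unfolding has_grad_def by (intro has_derivative_mult_right) auto
    have eq: "(\<lambda>h. gx (x, - y) * fst (fst h, - snd h) + gy (x, - y) * snd (fst h, - snd h))
        = (\<lambda>h. c * (gx (x, y) * fst h + gy (x, y) * snd h))"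
      by (rule has_derivative_unique[OF A[unfolded B] C])
    show ?thesis using fun_cong[OF eq, of "(1, 0)"] fun_cong[OF eq, of "(0, 1)"] by simp
  qed
  then show "parity c (dx g)" "parity (- c) (dy g)" unfolding parity_def gx gy by auto
qed

lemma parity_generators:
  "lam (x, - y) = lam (x, y)" "xi (x, - y) = xi (x, y)" "ze (x, - y) = - ze (x, y)"
  "sg (x, - y) = - sg (x, y)" "th (x, - y) = - th (x, y)" "sech2 (x, - y) = sech2 (x, y)"
  "logp (x, - y) = logp (x, y)"
  by (simp_all add: lam_def xi_def ze_def sg_def th_def sech2_def logp_def)

lemma parity_vel1: "parity 1 vel1" and parity_vel2: "parity (- 1) vel2" and parity_pot: "parity 1 pot"
  by (simp_all add: parity_def vel1_def vel2_def amp1_def amp2_def pot_def parity_generators algebra_simps)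

lemma parity_pres: "parity 1 pres"
  using parity_dy[OF parity_vel2 symb_has_grad[OF symb_vel2]] parity_vel2
    parity_dx[OF parity_pot symb_has_grad[OF symb_pot]]
  by (simp add: parity_def pres_def)

lemma parity_stress12: "parity (- 1) stress12" and parity_stress22: "parity 1 stress22" and parity_force2: "parity (- 1) force2"
proof -
  note sg = symb_flow[THEN symb_has_grad]
  have ux: "parity 1 (dx vel1)" and uy: "parity (- 1) (dy vel1)"
    using parity_dx[OF parity_vel1] parity_dy[OF parity_vel1] sg by blast+
  have vx: "parity (- 1) (dx vel2)" and vy: "parity 1 (dy vel2)"
    using parity_dx[OF parity_vel2] parity_dy[OF parity_vel2] sg by fastforce+
  have "parity (- 1) (dx (dx vel2))" "parity (- 1) (dy (dy vel2))" "parity (- 1) (dy pres)"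
    using parity_dx[OF vx] parity_dy[OF vy] parity_dy[OF parity_pres] sg by blast+
  with ux uy vx vy show "parity (- 1) stress12" "parity 1 stress22" "parity (- 1) force2"
    using parity_vel1 parity_vel2 parity_pres
    by (simp_all add: parity_def stress12_def stress22_def force2_def)
qed

section \<open>Momentum flux\<close>

text \<open>
  By its order, \<open>stress12\<close> is only \<open>O(\<rho>\<^sup>-\<^sup>1)\<close>, too large for its integral over a curve of length
  \<open>\<rho>\<close> to vanish in the limit.  Where it is large \<open>y\<close> is small, so the factor \<open>y\<close> costs only
  \<open>\<rho>\<^bsup>2/3\<^esup>\<close>; on a circle this factor comes from the normal, and on horizontal lines \<open>y\<close> is
  large.
\<close>

lemma snd_stress12_bound: "\<exists>C. \<forall>z. \<bar>snd z * stress12 z\<bar> \<le> C * lam z"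
proof -
  have zu: "symb 2 (\<lambda>z. ze z * vel1 z)"
    by (rule symb_factor[where m = 2 and h = "\<lambda>z. 3 * ((1 + xi z) * (sg z * sech2 z)) + ze z ^ 2 * amp1 z"])
      (intro symb0_intros symb_amp1, unfold vel1_def ze_eq, algebra, simp)
  have "symb 4 (\<lambda>z. ze z * vel1 z * vel2 z)" using symb_mult[OF zu symb_vel2] by simp
  moreover have "symb 4 (\<lambda>z. ze z * dy vel1 z)" using symb_ze_dy[OF symb_vel1] by (simp add: eval_nat_numeral)
  moreover have "symb 4 (\<lambda>z. ze z * dx vel2 z)"
    by (rule symb_mono[OF _ symb_mult0[OF symb_ze symb_flow(6)]]) simp
  ultimately have "symb 4 (\<lambda>z. ze z * dy vel1 z + ze z * dx vel2 z - ze z * vel1 z * vel2 z)"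
    by (intro symb_add symb_diff)
  then have "symb 4 (\<lambda>z. ze z * stress12 z)"
    by (rule symb_cong) (simp add: stress12_def algebra_simps)
  then obtain C where C: "\<bar>ze z * stress12 z\<bar> \<le> C * lam z ^ 4" for z using symb_bound by blast
  have "\<bar>snd z * stress12 z\<bar> \<le> C * lam z" for z
  proof -
    have "lam z ^ 3 * \<bar>snd z * stress12 z\<bar> = \<bar>ze z * stress12 z\<bar>"
      using lam_pos[of z] by (simp add: ze_def abs_mult)
    also have "\<dots> \<le> lam z ^ 3 * (C * lam z)" using C[of z] by (simp add: eval_nat_numeral mult_ac)
    finally show ?thesis using lam_pos[of z] by simp
  qed
  then show ?thesis by blast
qed

text \<open>
  The momentum flux of the jet is \<open>36 lam\<^sup>2 sech2\<^sup>2\<close> in the right half plane and negligible in the left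
  one; there \<open>1 + xi\<close> is bounded by \<open>1 - xi\<^sup>2\<close>.
\<close>

lemma stress11_bounds:
  obtains C where "\<And>z. 0 \<le> fst z \<Longrightarrow> \<bar>stress11 z + 36 * lam z ^ 2 * sech2 z ^ 2\<bar> \<le> C * lam z ^ 4"
    "\<And>z. fst z \<le> 0 \<Longrightarrow> \<bar>stress11 z\<bar> \<le> C * lam z ^ 4"
proof -
  have "symb 4 (\<lambda>z. 2 * dx vel1 z - pres z - (vel1 z * vel1 z - lead_square z))"
    by (intro symb_diff symb_cmult symb_flow vel1_sq_leading)
  then have "symb 4 (\<lambda>z. stress11 z + lead_square z)" by (rule symb_cong) (simp add: stress11_def)
  then obtain C where C: "\<bar>stress11 z + lead_square z\<bar> \<le> C * lam z ^ 4" for z using symb_bound by blast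
  have "symb 4 (\<lambda>z. 18 * lam z ^ 2 * (1 - xi z ^ 2) * sech2 z ^ 2)"
  proof (rule symb_factor)
    show "symb 0 (\<lambda>z. 18 * (lam z ^ 4 * (sech2 z * sech2 z) + sech2 z * (sg z ^ 2 * sech2 z)))" by (intro symb0_intros)
    show "18 * lam z ^ 2 * (1 - xi z ^ 2) * sech2 z ^ 2
        = lam z ^ 4 * (18 * (lam z ^ 4 * (sech2 z * sech2 z) + sech2 z * (sg z ^ 2 * sech2 z)))" for z
      unfolding one_minus_xi_sq by algebra
  qed simp
  then obtain D where D: "\<bar>18 * lam z ^ 2 * (1 - xi z ^ 2) * sech2 z ^ 2\<bar> \<le> D * lam z ^ 4" for z
    using symb_bound by blast
  have le: "18 * lam z ^ 2 * (1 - \<bar>xi z\<bar>) * sech2 z ^ 2 \<le> D * lam z ^ 4" for z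
  proof -
    have "\<bar>xi z\<bar> ^ 2 \<le> \<bar>xi z\<bar>" using power_decreasing[of 1 2 "\<bar>xi z\<bar>"] abs_xi_le_1[of z] by simp
    then have "18 * lam z ^ 2 * (1 - \<bar>xi z\<bar>) * sech2 z ^ 2 \<le> 18 * lam z ^ 2 * (1 - xi z ^ 2) * sech2 z ^ 2"
      by (intro mult_right_mono mult_left_mono) auto
    then show ?thesis using D[of z] by linarith
  qed
  have nn: "0 \<le> 18 * lam z ^ 2 * (1 - \<bar>xi z\<bar>) * sech2 z ^ 2" for z
    using abs_xi_le_1[of z] by (intro mult_nonneg_nonneg) auto
  show ?thesis
  proof
    fix z :: "real \<times> real"
    {
      assume "0 \<le> fst z"
      then have a: "\<bar>xi z\<bar> = xi z" using lam_pos[of z] by (simp add: xi_def)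
      have e: "stress11 z + 36 * lam z ^ 2 * sech2 z ^ 2
          = (stress11 z + lead_square z) + 18 * lam z ^ 2 * (1 - \<bar>xi z\<bar>) * sech2 z ^ 2"
        unfolding lead_square_def a by algebra
      then show "\<bar>stress11 z + 36 * lam z ^ 2 * sech2 z ^ 2\<bar> \<le> (C + D) * lam z ^ 4"
        unfolding e distrib_right using C[of z] le[of z] nn[of z] by linarith
    next
      assume "fst z \<le> 0"
      then have a: "\<bar>xi z\<bar> = - xi z" using lam_pos[of z] by (simp add: xi_def mult_nonpos_nonneg)
      have e: "stress11 z - 0 = (stress11 z + lead_square z) - 18 * lam z ^ 2 * (1 - \<bar>xi z\<bar>) * sech2 z ^ 2"
        unfolding lead_square_def a by algebra
      then show "\<bar>stress11 z\<bar> \<le> (C + D) * lam z ^ 4"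
        using e C[of z] le[of z] nn[of z] unfolding distrib_right by linarith
    }
  qed
qed

text \<open>
  An antiderivative of the fourth power of sech, the profile of the momentum flux.
\<close>

definition sech4_primitive :: "real \<Rightarrow> real" where "sech4_primitive s = tanh s - tanh s ^ 3 / 3"

lemma sech4_primitive_deriv [THEN DERIV_chain2, derivative_intros]: "(sech4_primitive has_field_derivative (1 - tanh s ^ 2) ^ 2) (at s)"
proof -
  have "(sech4_primitive has_field_derivative (1 - tanh s ^ 2) - 3 * tanh s ^ 2 * (1 - tanh s ^ 2) / 3) (at s)"
    unfolding sech4_primitive_def[abs_def] by (auto intro!: derivative_eq_intros)
  moreover have "(1 - tanh s ^ 2) - 3 * tanh s ^ 2 * (1 - tanh s ^ 2) / 3 = (1 - tanh s ^ 2) ^ 2"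
    by algebra
  ultimately show ?thesis by simp
qed

lemma sech4_primitive_minus: "sech4_primitive (- s) = - sech4_primitive s" by (simp add: sech4_primitive_def)

lemma sech4_primitive_lim: "(sech4_primitive \<longlongrightarrow> 2 / 3) at_top"
proof -
  have "(sech4_primitive \<longlongrightarrow> 1 - 1 ^ 3 / 3) at_top"
    unfolding sech4_primitive_def[abs_def] by (intro tendsto_intros tanh_real_at_top) auto
  then show ?thesis by simp
qed

lemma symb_continuous: "symb n g \<Longrightarrow> continuous_on S g"
  using symb_has_grad[of n g] unfolding has_grad_def
  by (meson continuous_at_imp_continuous_on has_derivative_continuous)

lemma fst_lam3_le: "\<bar>x\<bar> * lam (x, 0) ^ 3 \<le> 1"
  using abs_xi_le_1[of "(x, 0)"] lam_pos[of "(x, 0)"] by (simp add: xi_def abs_mult)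

lemma lam_mono: "x ^ 2 + y ^ 2 \<le> fst z ^ 2 + snd z ^ 2 \<Longrightarrow> lam z \<le> lam (x, y)"
  unfolding lam_def by (rule powr_mono2') (auto simp: one_plus_pos)

lemma lam_lim: "((\<lambda>R. lam (R, 0)) \<longlongrightarrow> 0) at_top"
  unfolding lam_def by simp real_asymp

lemma integral_close:
  fixes G H :: "real \<Rightarrow> real"
  assumes "continuous_on {a..b} G" "(H has_integral I) {a..b}" "a \<le> b"
    "\<And>x. x \<in> {a..b} \<Longrightarrow> \<bar>G x - H x\<bar> \<le> K"
  shows "\<bar>integral {a..b} G - I\<bar> \<le> K * (b - a)"
proof -
  have "(G has_integral integral {a..b} G) {a..b}"
    using assms(1) integrable_continuous_real by (simp add: has_integral_integral)
  then have "((\<lambda>x. G x - H x) has_integral (integral {a..b} G - I)) {a..b}"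
    using assms(2) by (rule has_integral_diff)
  moreover have "0 \<le> K" using assms(3) assms(4)[of a] by auto
  ultimately have "norm (integral {a..b} G - I) \<le> K * measure lborel {a..b}"
    using assms(4) by (intro has_integral_bound_real[where f = "\<lambda>x. G x - H x"]) auto
  then show ?thesis using assms(3) by simp
qed

text \<open>
  The circle of radius \<open>r\<close>, and the two components of the stress acting on it, with the arc length element
  \<open>r dt\<close>.
\<close>

definition circ :: "real \<Rightarrow> real \<Rightarrow> real \<times> real" where
  "circ r t = (r * cos t, r * sin t)"

definition flux1 :: "real \<Rightarrow> real \<Rightarrow> real" where
  "flux1 r t = r * (stress11 (circ r t) * cos t + stress12 (circ r t) * sin t)"

definition flux2 :: "real \<Rightarrow> real \<Rightarrow> real" where
  "flux2 r t = r * (stress12 (circ r t) * cos t + stress22 (circ r t) * sin t)"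

lemma continuous_circ: "symb n g \<Longrightarrow> continuous_on S (\<lambda>t. g (circ r t))"
  by (rule continuous_on_compose2[OF symb_continuous[where S = UNIV]])
    (auto simp: circ_def intro!: continuous_intros)

lemma continuous_flux: "continuous_on S (flux1 r)" "continuous_on S (flux2 r)"
  unfolding flux1_def[abs_def] flux2_def[abs_def]
  by (intro continuous_intros continuous_circ[OF symb_stress11] continuous_circ[OF symb_stress12] continuous_circ[OF symb_stress22])+

lemma lam_circ: "lam (circ r t) = lam (r, 0)"
proof -
  have "(r * cos t)\<^sup>2 + (r * sin t)\<^sup>2 = r\<^sup>2"
    by (simp add: power_mult_distrib flip: distrib_left)
  then show ?thesis by (simp add: lam_def circ_def add.assoc)
qed

text \<open>
  On a circle \<open>lam\<close> is constant, so \<open>sg = r sin t lam\<^sup>2\<close> and \<open>r lam\<^sup>2 cos t dt = d sg\<close>: the flux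
  \<open>36 lam\<^sup>2 sech2\<^sup>2\<close> through the right half circle integrates exactly.  All remaining terms are
  bounded pointwise by a multiple of \<open>lam\<close>.
\<close>

lemma circle_flux1: "((\<lambda>r. integral {0..2*pi} (flux1 r)) \<longlongrightarrow> - 48) at_top"
proof -
  obtain C where C: "\<And>z. 0 \<le> fst z \<Longrightarrow> \<bar>stress11 z + 36 * lam z ^ 2 * sech2 z ^ 2\<bar> \<le> C * lam z ^ 4"
    "\<And>z. fst z \<le> 0 \<Longrightarrow> \<bar>stress11 z\<bar> \<le> C * lam z ^ 4" using stress11_bounds by blast
  obtain D where D: "\<And>z. \<bar>snd z * stress12 z\<bar> \<le> D * lam z" using snd_stress12_bound by blast
  have "0 \<le> C * lam (0, 0) ^ 4" using C(2)[of "(0, 0)"] by (simp add: order_trans[OF abs_ge_zero])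
  then have C0: "0 \<le> C" using lam_pos[of "(0, 0)"] by (simp add: zero_le_mult_iff)
  have main: "\<bar>integral {0..2*pi} (flux1 r) + 72 * sech4_primitive (r * lam (r, 0) ^ 2)\<bar> \<le> 2 * pi * (C + D) * lam (r, 0)"
    if r: "0 \<le> r" for r
  proof -
    define l where "l = lam (r, 0)"
    \<comment> \<open>\<open>r l\<^sup>3\<close> is \<open>xi (r, 0)\<close>.\<close>
    have l: "0 < l" "r * l ^ 3 \<le> 1" using lam_pos fst_lam3_le[of r] r by (auto simp: l_def)
    have rl: "r * (c * (C * l ^ 4)) \<le> C * l" if "0 \<le> c" "c \<le> 1" for c
    proof -
      have "r * (c * (C * l ^ 4)) = (r * l ^ 3) * (c * (C * l))" by (simp add: eval_nat_numeral mult_ac)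
      also have "\<dots> \<le> 1 * (1 * (C * l))" using l r C0 that by (intro mult_mono) auto
      finally show ?thesis by simp
    qed
    have stress12: "\<bar>r * sin t * stress12 (circ r t)\<bar> \<le> D * l" for t
      using D[of "circ r t"] by (simp add: lam_circ l_def) (simp add: circ_def)
    define H where "H t = - 36 * (r * cos t * l ^ 2) * (1 - tanh (r * sin t * l ^ 2) ^ 2) ^ 2" for t
    have sech2: "sech2 (circ r t) = 1 - tanh (r * sin t * l ^ 2) ^ 2" for t
      by (simp add: sech2_def th_def sg_def lam_circ l_def) (simp add: circ_def)
    have FTC: "(H has_integral (- 36 * sech4_primitive (r * sin b * l ^ 2)) - (- 36 * sech4_primitive (r * sin a * l ^ 2))) {a..b}"
      if "a \<le> b" for a b
      unfolding H_def
      by (intro fundamental_theorem_of_calculus that)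
        (auto intro!: derivative_eq_intros simp flip: has_real_derivative_iff_has_vector_derivative)
    have right: "\<bar>flux1 r t - H t\<bar> \<le> (C + D) * l" if "0 \<le> cos t" for t
    proof -
      have "flux1 r t - H t = r * (cos t * (stress11 (circ r t) + 36 * lam (circ r t) ^ 2 * sech2 (circ r t) ^ 2))
          + r * sin t * stress12 (circ r t)"
        unfolding flux1_def H_def sech2 lam_circ l_def[symmetric] by algebra
      moreover have "\<bar>r * (cos t * (stress11 (circ r t) + 36 * lam (circ r t) ^ 2 * sech2 (circ r t) ^ 2))\<bar>
          \<le> r * (cos t * (C * l ^ 4))"
      proof -
        have "0 \<le> fst (circ r t)" using that r by (simp add: circ_def)
        then have "\<bar>stress11 (circ r t) + 36 * lam (circ r t) ^ 2 * sech2 (circ r t) ^ 2\<bar> \<le> C * l ^ 4"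
          using C(1)[of "circ r t"] by (simp only: lam_circ l_def)
        then show ?thesis using r that by (simp only: abs_mult abs_of_nonneg mult_left_mono abs_ge_zero)
      qed
      ultimately show ?thesis using stress12[of t] rl[of "cos t"] that by (simp add: distrib_right)
    qed
    have left: "\<bar>flux1 r t - 0\<bar> \<le> (C + D) * l" if "cos t \<le> 0" for t
    proof -
      have "flux1 r t = r * (cos t * stress11 (circ r t)) + r * sin t * stress12 (circ r t)"
        unfolding flux1_def by algebra
      moreover have "\<bar>r * (cos t * stress11 (circ r t))\<bar> \<le> r * (\<bar>cos t\<bar> * (C * l ^ 4))"
      proof -
        have "fst (circ r t) \<le> 0" using that r by (simp add: circ_def mult_nonneg_nonpos)
        then have "\<bar>stress11 (circ r t)\<bar> \<le> C * l ^ 4"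
          using C(2)[of "circ r t"] by (simp only: lam_circ l_def)
        then show ?thesis using r by (simp only: abs_mult abs_of_nonneg mult_left_mono abs_ge_zero)
      qed
      ultimately show ?thesis using stress12[of t] rl[of "\<bar>cos t\<bar>"] by (simp add: distrib_right)
    qed
    have cos1: "0 \<le> cos t" if "t \<in> {0..pi/2}" for t using that by (auto intro!: cos_ge_zero)
    have cos2: "cos t \<le> 0" if "t \<in> {pi/2..3*pi/2}" for t
      using cos_ge_zero[of "t - pi"] that by (auto simp: cos_diff)
    have cos3: "0 \<le> cos t" if "t \<in> {3*pi/2..2*pi}" for t
      using cos_ge_zero[of "t - 2*pi"] that by (auto simp: cos_diff)
    have s3: "sin (3*pi/2) = -1" using sin_3over2_pi by (simp add: mult.commute)
    have I1: "\<bar>integral {0..pi/2} (flux1 r) - (- 36 * sech4_primitive (r * sin (pi/2) * l ^ 2) - (- 36 * sech4_primitive (r * sin 0 * l ^ 2)))\<bar>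
        \<le> (C + D) * l * (pi/2 - 0)"
      by (rule integral_close[OF continuous_flux(1) FTC _ right]) (auto intro: cos1)
    have I2: "\<bar>integral {pi/2..3*pi/2} (flux1 r) - 0\<bar> \<le> (C + D) * l * (3*pi/2 - pi/2)"
      by (rule integral_close[OF continuous_flux(1) has_integral_0 _ left]) (auto intro: cos2)
    have I3: "\<bar>integral {3*pi/2..2*pi} (flux1 r) - (- 36 * sech4_primitive (r * sin (2*pi) * l ^ 2) - (- 36 * sech4_primitive (r * sin (3*pi/2) * l ^ 2)))\<bar>
        \<le> (C + D) * l * (2*pi - 3*pi/2)"
      by (rule integral_close[OF continuous_flux(1) FTC _ right]) (auto intro: cos3)
    have "integral {0..2*pi} (flux1 r) = integral {0..pi/2} (flux1 r) + integral {pi/2..3*pi/2} (flux1 r)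
        + integral {3*pi/2..2*pi} (flux1 r)"
      by (simp add: Henstock_Kurzweil_Integration.integral_combine integrable_continuous_real continuous_flux)
    moreover have "sech4_primitive 0 = 0" by (simp add: sech4_primitive_def)
    ultimately have "\<bar>integral {0..2*pi} (flux1 r) + 72 * sech4_primitive (r * l ^ 2)\<bar>
        \<le> (C + D) * l * (pi/2 - 0) + (C + D) * l * (3*pi/2 - pi/2) + (C + D) * l * (2*pi - 3*pi/2)"
      using I1 I2 I3 unfolding s3 by (simp add: sech4_primitive_minus[of "r * l\<^sup>2"] del: mult_eq_0_iff) argo
    also have "\<dots> = 2 * pi * (C + D) * l" by (simp add: algebra_simps)
    finally show ?thesis unfolding l_def .
  qed
  have lim: "filterlim (\<lambda>r. r * lam (r, 0) ^ 2) at_top at_top"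
    unfolding lam_def by simp real_asymp
  have "((\<lambda>r. 72 * sech4_primitive (r * lam (r, 0) ^ 2)) \<longlongrightarrow> 72 * (2/3)) at_top"
    by (intro tendsto_intros filterlim_compose[OF sech4_primitive_lim lim])
  moreover have "((\<lambda>r. integral {0..2*pi} (flux1 r) + 72 * sech4_primitive (r * lam (r, 0) ^ 2)) \<longlongrightarrow> 0) at_top"
  proof (rule Lim_null_comparison)
    show "\<forall>\<^sub>F r in at_top. norm (integral {0..2*pi} (flux1 r) + 72 * sech4_primitive (r * lam (r, 0) ^ 2))
        \<le> 2 * pi * (C + D) * lam (r, 0)"
      using eventually_ge_at_top[of 0] by eventually_elim (use main in simp)
    show "((\<lambda>r. 2 * pi * (C + D) * lam (r, 0)) \<longlongrightarrow> 0) at_top"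
      using tendsto_mult_right_zero[OF lam_lim] by blast
  qed
  ultimately show ?thesis using tendsto_diff by force
qed

lemma circle_flux2: "integral {-pi..pi} (flux2 r) = 0"
proof -
  have refl: "circ r (- t) = (fst (circ r t), - snd (circ r t))" for t by (simp add: circ_def)
  have "flux2 r (- t) = - flux2 r t" for t
    using parity_stress12 parity_stress22 unfolding flux2_def refl parity_def
    by (simp add: algebra_simps)
  then have "integral {-pi..pi} (flux2 r) = - integral {-pi..pi} (flux2 r)"
    using Henstock_Kurzweil_Integration.integral_reflect_real[of pi "- pi" "flux2 r"]
    by (simp only: minus_minus integral_neg)
  then show ?thesis by simp
qed

text \<open>
  On the line \<open>x = R\<close>, \<open>lam\<^sup>2 dy\<close> agrees with \<open>d sg\<close> up to a negligible term, so that the same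
  antiderivative applies; the flux through the other three sides of the square is negligible.
\<close>

lemma box_flux:
  "((\<lambda>R. integral {-R..R} (\<lambda>x. integral {-R..R} (\<lambda>y. force1 (x, y)))) \<longlongrightarrow> - 48) at_top"
proof -
  obtain C where C: "\<And>z. 0 \<le> fst z \<Longrightarrow> \<bar>stress11 z + 36 * lam z ^ 2 * sech2 z ^ 2\<bar> \<le> C * lam z ^ 4"
    "\<And>z. fst z \<le> 0 \<Longrightarrow> \<bar>stress11 z\<bar> \<le> C * lam z ^ 4" using stress11_bounds by blast
  obtain D where D: "\<And>z. \<bar>snd z * stress12 z\<bar> \<le> D * lam z" using snd_stress12_bound by blast
  have "symb 0 (\<lambda>z. 24 * (sech2 z * (sg z ^ 2 * sech2 z)))" by (intro symb0_intros)
  then obtain E where E: "\<And>z. \<bar>24 * (sech2 z * (sg z ^ 2 * sech2 z))\<bar> \<le> E * lam z ^ 0" using symb_bound by blast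
  have "0 \<le> C * lam (0, 0) ^ 4" using C(2)[of "(0, 0)"] by (simp add: order_trans[OF abs_ge_zero])
  then have C0: "0 \<le> C" using lam_pos[of "(0, 0)"] by (simp add: zero_le_mult_iff)
  have E0: "0 \<le> E" using E[of "(0, 0)"] by simp
  have "0 \<le> D * lam (0, 0)" using D[of "(0, 0)"] by (simp add: order_trans[OF abs_ge_zero])
  then have D0: "0 \<le> D" using lam_pos[of "(0, 0)"] by (simp add: zero_le_mult_iff)
  let ?S = "\<lambda>R. sech4_primitive (sg (R, R))"
  have main: "\<bar>integral {-R..R} (\<lambda>x. integral {-R..R} (\<lambda>y. force1 (x, y))) + 72 * ?S R\<bar>
      \<le> (4 * C + 2 * E + 4 * D) * lam (R, 0)" if R: "0 < R" for R
  proof -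
    define l where "l = lam (R, 0)"
    have l: "0 < l" "R * l ^ 3 \<le> 1" using lam_pos fst_lam3_le[of R] R by (auto simp: l_def)
    have Rl: "R * l ^ 4 \<le> l"
      using mult_right_mono[OF l(2), of l] l by (simp add: eval_nat_numeral mult_ac)
    have lx: "lam (x, y) ^ 4 \<le> l ^ 4" if "\<bar>x\<bar> = R" for x y
      unfolding l_def using that by (intro power_mono lam_mono less_imp_le[OF lam_pos]) auto
    have ly: "lam (x, y) \<le> l" if "\<bar>y\<bar> = R" for x y
      unfolding l_def using that by (intro lam_mono) auto
    have c1: "continuous_on S (\<lambda>y. g (x, y))" if "symb n g" for S g n and x :: real
      by (rule continuous_on_compose2[OF symb_continuous[OF that, of UNIV]]) (auto intro!: continuous_intros)
    have c2: "continuous_on S (\<lambda>x. g (x, y))" if "symb n g" for S g n and y :: real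
      by (rule continuous_on_compose2[OF symb_continuous[OF that, of UNIV]]) (auto intro!: continuous_intros)
    have d1: "((\<lambda>x. g (x, y)) has_vector_derivative dx g (x, y)) (at x within S)"
      and d2: "((\<lambda>y. g (x, y)) has_vector_derivative dy g (x, y)) (at y within T)"
      if "symb n g" for n g x y S T
    proof -
      have g: "(g has_derivative (\<lambda>h. dx g (x, y) * fst h + dy g (x, y) * snd h)) (at (x, y))"
        using symb_has_grad[OF that] by (simp add: has_grad_def)
      have "((\<lambda>x. (x, y)) has_derivative (\<lambda>h. (h, 0))) (at x within S)"
        "((\<lambda>y. (x, y)) has_derivative (\<lambda>h. (0, h))) (at y within T)"
        by (auto intro!: derivative_eq_intros)
      from this[THEN has_derivative_compose, OF g]
      show "((\<lambda>x. g (x, y)) has_vector_derivative dx g (x, y)) (at x within S)"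
        "((\<lambda>y. g (x, y)) has_vector_derivative dy g (x, y)) (at y within T)"
        by (simp_all add: has_vector_derivative_def mult.commute)
    qed
    have sx: "symb 0 (dx stress11)" and sy: "symb 0 (dy stress12)"
      using symb_dx[OF symb_stress11] symb_dy[OF symb_stress12] by (auto intro: symb_mono[of 0 "0 + 3"] symb_mono[of 0 "0 + 2"])
    have cont: "continuous_on A (\<lambda>(x, y). g (x, y))" if "symb n g" for n g and A :: "(real \<times> real) set"
      using symb_continuous[OF that] by simp
    have int_x: "integral {-R..R} (\<lambda>x. dx stress11 (x, y)) = stress11 (R, y) - stress11 (- R, y)" for y
      using fundamental_theorem_of_calculus[of "- R" R "\<lambda>x. stress11 (x, y)"] d1[OF symb_stress11] R
      by (intro integral_unique) auto
    have int_y: "integral {-R..R} (\<lambda>y. dy stress12 (x, y)) = stress12 (x, R) - stress12 (x, - R)" for x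
      using fundamental_theorem_of_calculus[of "- R" R "\<lambda>y. stress12 (x, y)"] d2[OF symb_stress12] R
      by (intro integral_unique) auto
    have i: "(\<lambda>y. dx stress11 (x, y)) integrable_on {-R..R}" "(\<lambda>y. dy stress12 (x, y)) integrable_on {-R..R}" for x
      using c1[OF sx] c1[OF sy] by (auto intro: integrable_continuous_real)
    have i2: "(\<lambda>x. integral {-R..R} (\<lambda>y. dx stress11 (x, y))) integrable_on {-R..R}"
    proof -
      have "continuous_on (cbox (- R) R) (\<lambda>x. integral (cbox (- R) R) (\<lambda>y. dx stress11 (x, y)))"
        by (rule integral_continuous_on_param) (use cont[OF sx] in simp)
      then show ?thesis using integrable_continuous_real by simp
    qed
    have "integral {-R..R} (\<lambda>x. integral {-R..R} (\<lambda>y. force1 (x, y)))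
        = integral {-R..R} (\<lambda>x. integral {-R..R} (\<lambda>y. dx stress11 (x, y)) + (stress12 (x, R) - stress12 (x, - R)))"
      by (simp add: force1_div Henstock_Kurzweil_Integration.integral_add[OF i] int_y)
    also have "\<dots> = integral {-R..R} (\<lambda>x. integral {-R..R} (\<lambda>y. dx stress11 (x, y)))
        + integral {-R..R} (\<lambda>x. stress12 (x, R) - stress12 (x, - R))"
      by (intro Henstock_Kurzweil_Integration.integral_add i2 integrable_continuous_real continuous_intros c2[OF symb_stress12])
    also have "integral {-R..R} (\<lambda>x. integral {-R..R} (\<lambda>y. dx stress11 (x, y)))
        = integral {-R..R} (\<lambda>y. stress11 (R, y) - stress11 (- R, y))"
      using integral_swap_continuous[of "- R" "- R" R R "\<lambda>x y. dx stress11 (x, y)"] cont[OF sx] int_x by simp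
    also have "\<dots> = integral {-R..R} (\<lambda>y. stress11 (R, y)) - integral {-R..R} (\<lambda>y. stress11 (- R, y))"
      by (intro Henstock_Kurzweil_Integration.integral_diff integrable_continuous_real c1[OF symb_stress11])
    finally have eq: "integral {-R..R} (\<lambda>x. integral {-R..R} (\<lambda>y. force1 (x, y)))
        = integral {-R..R} (\<lambda>y. stress11 (R, y)) - integral {-R..R} (\<lambda>y. stress11 (- R, y))
          + integral {-R..R} (\<lambda>x. stress12 (x, R) - stress12 (x, - R))" .
    have top: "\<bar>integral {-R..R} (\<lambda>x. stress12 (x, R) - stress12 (x, - R)) - 0\<bar> \<le> (2 * D * l / R) * (R - - R)"
    proof (rule integral_close)
      fix x assume "x \<in> {-R..R}"
      have "R * \<bar>stress12 (x, y)\<bar> \<le> D * l" if "\<bar>y\<bar> = R" for y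
      proof -
        have "R * \<bar>stress12 (x, y)\<bar> \<le> D * lam (x, y)" using D[of "(x, y)"] that by (simp add: abs_mult)
        also have "\<dots> \<le> D * l" using ly[OF that] D0 by (intro mult_left_mono)
        finally show ?thesis .
      qed
      from this[of R] this[of "- R"] have "R * \<bar>stress12 (x, R) - stress12 (x, - R)\<bar> \<le> 2 * D * l"
        using R abs_triangle_ineq4[of "stress12 (x, R)" "stress12 (x, - R)"]
          mult_left_mono[OF abs_triangle_ineq4[of "stress12 (x, R)" "stress12 (x, - R)"], of R]
        by (simp add: distrib_left)
      then show "\<bar>stress12 (x, R) - stress12 (x, - R) - 0\<bar> \<le> 2 * D * l / R"
        using R by (simp add: field_simps)
    qed (use R in \<open>auto intro!: continuous_intros c2[OF symb_stress12]\<close>)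
    have left: "\<bar>integral {-R..R} (\<lambda>y. stress11 (- R, y)) - 0\<bar> \<le> (C * l ^ 4) * (R - - R)"
    proof (rule integral_close)
      fix y
      have "\<bar>stress11 (- R, y)\<bar> \<le> C * lam (- R, y) ^ 4" using C(2)[of "(- R, y)"] R by simp
      also have "\<dots> \<le> C * l ^ 4" using lx[of "- R" y] R C0 by (intro mult_left_mono) auto
      finally show "\<bar>stress11 (- R, y) - 0\<bar> \<le> C * l ^ 4" by simp
    qed (use R in \<open>auto intro!: c1[OF symb_stress11]\<close>)
    have right: "\<bar>integral {-R..R} (\<lambda>y. stress11 (R, y)) - (- 36 * sech4_primitive (sg (R, R)) - (- 36 * sech4_primitive (sg (R, - R))))\<bar>
        \<le> ((C + E) * l ^ 4) * (R - - R)"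
    proof (rule integral_close)
      show "((\<lambda>y. - 36 * (sech2 (R, y) ^ 2 * sgy (R, y))) has_integral
          (- 36 * sech4_primitive (sg (R, R)) - (- 36 * sech4_primitive (sg (R, - R))))) {-R..R}"
      proof (rule fundamental_theorem_of_calculus)
        fix y
        have "((\<lambda>y. sg (R, y)) has_real_derivative sgy (R, y)) (at y within {-R..R})"
        proof -
          have "((\<lambda>y. (R, y)) has_derivative (\<lambda>h. (0, h))) (at y within {-R..R})"
            by (auto intro!: derivative_eq_intros)
          from has_derivative_compose[OF this has_grad_sg[unfolded has_grad_def, rule_format]]
          show ?thesis by (simp add: has_field_derivative_def)
        qed
        from DERIV_cmult[OF sech4_primitive_deriv[OF this], of "- 36"]
        show "((\<lambda>y. - 36 * sech4_primitive (sg (R, y))) has_vector_derivative - 36 * (sech2 (R, y) ^ 2 * sgy (R, y)))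
            (at y within {-R..R})"
          by (simp add: sech2_def th_def mult_ac flip: has_real_derivative_iff_has_vector_derivative)
      qed (use R in auto)
      fix y
      have "stress11 (R, y) - - 36 * (sech2 (R, y) ^ 2 * sgy (R, y))
          = (stress11 (R, y) + 36 * lam (R, y) ^ 2 * sech2 (R, y) ^ 2)
            - lam (R, y) ^ 4 * (24 * (sech2 (R, y) * (sg (R, y) ^ 2 * sech2 (R, y))))"
        unfolding ze_eq by algebra
      moreover have "\<bar>stress11 (R, y) + 36 * lam (R, y) ^ 2 * sech2 (R, y) ^ 2\<bar> \<le> C * lam (R, y) ^ 4"
        using C(1)[of "(R, y)"] R by simp
      moreover have "\<bar>lam (R, y) ^ 4 * (24 * (sech2 (R, y) * (sg (R, y) ^ 2 * sech2 (R, y))))\<bar> \<le> lam (R, y) ^ 4 * E"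
        using E[of "(R, y)"] unfolding abs_mult[of "lam (R, y) ^ 4"] by (intro mult_mono) auto
      ultimately have "\<bar>stress11 (R, y) - - 36 * (sech2 (R, y) ^ 2 * sgy (R, y))\<bar> \<le> (C + E) * lam (R, y) ^ 4"
        by (simp add: algebra_simps)
      also have "\<dots> \<le> (C + E) * l ^ 4" using lx[of R y] R C0 E0 by (intro mult_left_mono) auto
      finally show "\<bar>stress11 (R, y) - - 36 * (sech2 (R, y) ^ 2 * sgy (R, y))\<bar> \<le> (C + E) * l ^ 4" .
    qed (use R in \<open>auto intro!: c1[OF symb_stress11]\<close>)
    have "sech4_primitive (sg (R, - R)) = - sech4_primitive (sg (R, R))" by (simp add: parity_generators sech4_primitive_minus)
    then have "\<bar>integral {-R..R} (\<lambda>x. integral {-R..R} (\<lambda>y. force1 (x, y))) + 72 * sech4_primitive (sg (R, R))\<bar>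
        \<le> ((C + E) * l ^ 4) * (R - - R) + (C * l ^ 4) * (R - - R) + (2 * D * l / R) * (R - - R)"
      using top left right unfolding eq by linarith
    also have "\<dots> = (4 * C + 2 * E) * (R * l ^ 4) + 4 * D * l"
      using R by (simp add: field_simps)
    also have "\<dots> \<le> (4 * C + 2 * E) * l + 4 * D * l"
      using mult_left_mono[OF Rl, of "4 * C + 2 * E"] C0 E0 by simp
    finally show ?thesis by (simp add: l_def algebra_simps)
  qed
  have lim: "filterlim (\<lambda>R. sg (R, R)) at_top at_top"
    unfolding sg_def lam_def by simp real_asymp
  have "((\<lambda>R. 72 * ?S R) \<longlongrightarrow> 72 * (2/3)) at_top"
    by (intro tendsto_intros filterlim_compose[OF sech4_primitive_lim lim])
  moreover have "((\<lambda>R. integral {-R..R} (\<lambda>x. integral {-R..R} (\<lambda>y. force1 (x, y))) + 72 * ?S R) \<longlongrightarrow> 0) at_top"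
  proof (rule Lim_null_comparison)
    show "\<forall>\<^sub>F R in at_top. norm (integral {-R..R} (\<lambda>x. integral {-R..R} (\<lambda>y. force1 (x, y))) + 72 * ?S R)
        \<le> (4 * C + 2 * E + 4 * D) * lam (R, 0)"
      using eventually_gt_at_top[of 0] by eventually_elim (use main in simp)
    show "((\<lambda>R. (4 * C + 2 * E + 4 * D) * lam (R, 0)) \<longlongrightarrow> 0) at_top"
      using tendsto_mult_right_zero[OF lam_lim] by blast
  qed
  ultimately show ?thesis using tendsto_diff by force
qed

section \<open>The integral of the force over the plane\<close>

text \<open>
  Order \<open>7\<close> means decay like \<open>\<rho>\<^bsup>-7/3\<^esup>\<close>, which is at most \<open>((1 + x\<^sup>2) (1 + y\<^sup>2))\<^bsup>-7/12\<^esup>\<close>, a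
  product of integrable functions of one variable.
\<close>

lemma integrable_lborel_weight: "integrable lborel (\<lambda>x::real. (1 + x ^ 2) powr (- 7 / 12))"
proof -
  let ?a = "\<lambda>x::real. (1 + x ^ 2) powr (- 7 / 12)"
  have "((\<lambda>x::real. x powr (- 7 / 6)) has_integral - (1 powr (- 7 / 6 + 1)) / (- 7 / 6 + 1)) {1..}"
    by (rule has_integral_powr_to_inf) auto
  then have "(\<lambda>x::real. x powr (- 7 / 6)) absolutely_integrable_on {1..}"
    by (intro nonnegative_absolutely_integrable_1) auto
  then have "integrable lebesgue (\<lambda>x::real. indicator {1..} x *\<^sub>R x powr (- 7 / 6))"
    by (simp add: set_integrable_def)
  then have tail: "integrable lborel (\<lambda>x::real. indicator {1..} x *\<^sub>R x powr (- 7 / 6))"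
    by (subst (asm) integrable_completion) auto
  have tail': "integrable lborel (\<lambda>x::real. indicator {1..} (- x) *\<^sub>R (- x) powr (- 7 / 6))"
    using lborel_integrable_real_affine[OF tail, of "-1" 0] by simp
  have mid: "integrable lborel (\<lambda>x::real. indicator {-1..1} x :: real)"
    by simp
  show ?thesis
  proof (rule Bochner_Integration.integrable_bound[OF Bochner_Integration.integrable_add[OF mid Bochner_Integration.integrable_add[OF tail tail']]])
    show "?a \<in> borel_measurable lborel" by measurable
    have powr: "?a x \<le> x powr (- 7 / 6)" if "1 \<le> x" for x :: real
    proof -
      have "?a x \<le> (x ^ 2) powr (- 7 / 12)" using that by (intro powr_mono2') auto
      also have "\<dots> = (x powr 2) powr (- 7 / 12)" using that by simp
      also have "\<dots> = x powr (- 7 / 6)" by (simp only: powr_powr) simp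
      finally show ?thesis .
    qed
    have le1: "?a x \<le> 1" for x using powr_mono2'[of "- 7 / 12" 1 "1 + x ^ 2"] by simp
    show "AE x in lborel. norm (?a x) \<le> norm (indicator {-1..1} x
        + (indicator {1..} x *\<^sub>R x powr (- 7 / 6) + indicator {1..} (- x) *\<^sub>R (- x) powr (- 7 / 6)))"
    proof (rule AE_I2)
      fix x :: real
      consider "\<bar>x\<bar> \<le> 1" | "1 < x" | "x < -1" by linarith
      then show "norm (?a x) \<le> norm (indicator {-1..1} x
        + (indicator {1..} x *\<^sub>R x powr (- 7 / 6) + indicator {1..} (- x) *\<^sub>R (- x) powr (- 7 / 6)))"
      proof cases
        case 1
        then have "indicator {-1..1} x = (1::real)" by (simp add: indicator_def abs_le_iff)
        moreover have "0 \<le> indicator {1..} x *\<^sub>R x powr (- 7 / 6) + indicator {1..} (- x) *\<^sub>R (- x) powr (- 7 / 6)"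
          by simp
        ultimately show ?thesis
          unfolding real_norm_def using le1[of x] powr_ge_zero[of "1 + x ^ 2" "- 7 / 12"] by linarith
      qed (use powr[of x] powr[of "- x"] in \<open>auto simp: indicator_def\<close>)
    qed
  qed
qed

lemma symb7_integrable:
  assumes "symb 7 g"
  shows "integrable lborel g"
proof -
  obtain C where C: "\<And>z. \<bar>g z\<bar> \<le> C * lam z ^ 7" using symb_bound[OF assms] by blast
  let ?a = "\<lambda>x::real. (1 + x ^ 2) powr (- 7 / 12)"
  have "integrable (lborel \<Otimes>\<^sub>M lborel) (\<lambda>(x, y). ?a x * ?a y)"
    using integrable_lborel_weight
    by (intro lborel_pair.Fubini_integrable) (auto simp: norm_mult)
  then have w: "integrable lborel (\<lambda>z. C * (?a (fst z) * ?a (snd z)))"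
    by (simp add: lborel_prod split_def)
  show ?thesis
  proof (rule Bochner_Integration.integrable_bound[OF w])
    show "g \<in> borel_measurable lborel"
      using borel_measurable_continuous_onI[OF symb_continuous[OF assms]] by simp
    show "AE z in lborel. norm (g z) \<le> norm (C * (?a (fst z) * ?a (snd z)))"
    proof (rule AE_I2)
      fix z :: "real \<times> real"
      let ?x = "fst z" and ?y = "snd z"
      have C0: "0 \<le> C" using C[of "(0,0)"] lam_pos[of "(0,0)"]
        by (smt (verit) abs_ge_zero mult_neg_pos zero_less_power)
      have "(1 + ?x ^ 2) * (1 + ?y ^ 2) \<le> (1 + ?x ^ 2 + ?y ^ 2) ^ 2"
      proof -
        have "(1 + a) * (1 + b) \<le> (1 + a + b) ^ 2" if "0 \<le> a" "0 \<le> b" for a b :: real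
          using mult_nonneg_nonneg[OF that] mult_nonneg_nonneg[OF that(1,1)] mult_nonneg_nonneg[OF that(2,2)] that
          by (simp add: power2_eq_square algebra_simps)
        then show ?thesis by simp
      qed
      then have "((1 + ?x ^ 2 + ?y ^ 2) ^ 2) powr (- 7 / 12) \<le> ((1 + ?x ^ 2) * (1 + ?y ^ 2)) powr (- 7 / 12)"
        by (intro powr_mono2') (auto intro!: mult_pos_pos add_pos_nonneg)
      also have "\<dots> = ?a ?x * ?a ?y" by (rule powr_mult)
      also have "((1 + ?x ^ 2 + ?y ^ 2) ^ 2) powr (- 7 / 12) = lam z ^ 7"
      proof -
        have "lam z ^ 7 = (1 + ?x ^ 2 + ?y ^ 2) powr (- 7 / 6)"
          using one_plus_pos[of ?x ?y] by (simp add: lam_def powr_realpow[symmetric] powr_powr)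
        moreover have "(1 + ?x ^ 2 + ?y ^ 2) ^ 2 = (1 + ?x ^ 2 + ?y ^ 2) powr 2"
          using one_plus_pos[of ?x ?y] by simp
        ultimately show ?thesis by (simp only: powr_powr) simp
      qed
      finally have "C * lam z ^ 7 \<le> C * (?a ?x * ?a ?y)" using C0 by (rule mult_left_mono)
      then show "norm (g z) \<le> norm (C * (?a ?x * ?a ?y))" using C[of z] C0 by simp
    qed
  qed
qed

lemma lborel_integral_box_limit:
  fixes g :: "real \<times> real \<Rightarrow> real"
  assumes int: "integrable lborel g" and cont: "continuous_on UNIV g"
    and lim: "((\<lambda>R. integral {-R..R} (\<lambda>x. integral {-R..R} (\<lambda>y. g (x, y)))) \<longlongrightarrow> c) at_top"
  shows "integral\<^sup>L lborel g = c"
proof -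
  let ?A = "\<lambda>n. cbox (- real n, - real n) (real n, real n)"
  have inc: "incseq ?A" by (auto simp: incseq_def)
  have U: "(\<Union>n. ?A n) = UNIV"
  proof -
    have "\<exists>n. z \<in> ?A n" for z :: "real \<times> real"
    proof -
      obtain n where "max \<bar>fst z\<bar> \<bar>snd z\<bar> \<le> real n" using real_arch_simple by blast
      then have "z \<in> ?A n" by (cases z) auto
      then show ?thesis ..
    qed
    then show ?thesis by auto
  qed
  have "(\<lambda>n. LINT z:?A n|lborel. g z) \<longlonglongrightarrow> (LINT z:(\<Union>n. ?A n)|lborel. g z)"
    by (rule set_integral_cont_up[OF _ inc]) (use int in \<open>auto simp: U set_integrable_def\<close>)
  then have "(\<lambda>n. LINT z:?A n|lborel. g z) \<longlonglongrightarrow> integral\<^sup>L lborel g"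
    by (simp add: U set_lebesgue_integral_def)
  moreover have "(LINT z:?A n|lborel. g z)
      = integral {- real n..real n} (\<lambda>x. integral {- real n..real n} (\<lambda>y. g (x, y)))" for n
  proof -
    have "set_integrable lborel (?A n) g"
      unfolding set_integrable_def using int by (intro integrable_mult_indicator) auto
    then have "(LINT z:?A n|lborel. g z) = integral (?A n) g"
      by (rule set_borel_integral_eq_integral)
    also have "\<dots> = integral (cbox (- real n) (real n)) (\<lambda>x. integral (cbox (- real n) (real n)) (\<lambda>y. g (x, y)))"
      by (rule integral_prod_continuous) (use cont continuous_on_subset in blast)
    finally show ?thesis by simp
  qed
  moreover have "(\<lambda>n. integral {- real n..real n} (\<lambda>x. integral {- real n..real n} (\<lambda>y. g (x, y)))) \<longlonglongrightarrow> c"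
    using filterlim_compose[OF lim filterlim_real_sequentially] .
  ultimately show ?thesis using LIMSEQ_unique by simp
qed

lemma symb_force2_7: "symb 7 force2"
  by (rule symb_mono[OF _ symb_force2]) simp

lemma integral_force1: "integral\<^sup>L lborel force1 = - 48"
  by (rule lborel_integral_box_limit[OF symb7_integrable[OF symb_force1] symb_continuous[OF symb_force1] box_flux])

lemma integral_force2: "integral\<^sup>L lborel force2 = 0"
proof (rule lborel_integral_box_limit[OF symb7_integrable[OF symb_force2_7] symb_continuous[OF symb_force2_7]])
  have "integral {-R..R} (\<lambda>y. force2 (x, y)) = 0" for x R :: real
  proof -
    have "integral {-R..R} (\<lambda>y. force2 (x, y)) = integral {-R..R} (\<lambda>y. force2 (x, - y))"
      using Henstock_Kurzweil_Integration.integral_reflect_real[of R "- R" "\<lambda>y. force2 (x, y)"] by simp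
    also have "\<dots> = - integral {-R..R} (\<lambda>y. force2 (x, y))"
      using parity_force2 by (simp add: parity_def)
    finally show ?thesis by simp
  qed
  then show "((\<lambda>R. integral {-R..R} (\<lambda>x. integral {-R..R} (\<lambda>y. force2 (x, y)))) \<longlongrightarrow> 0) at_top"
    by simp
qed

section \<open>From jet coordinates to the Euclidean plane\<close>

text \<open>
  Lebesgue measure on \<^typ>\<open>real \<times> real\<close> is the image of the one on \<^typ>\<open>real^2\<close>.
\<close>

lemma lborel_plane: "lborel = distr (lborel :: (real^2) measure) borel (\<lambda>q. (q $ 1, q $ 2))"
proof (rule lborel_eqI)
  have meas: "(\<lambda>q::real^2. (q $ 1, q $ 2)) \<in> borel_measurable borel"
    by (intro borel_measurable_continuous_onI continuous_intros)
  fix l u :: "real \<times> real" assume lu: "\<And>b. b \<in> Basis \<Longrightarrow> l \<bullet> b \<le> u \<bullet> b"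
  have le: "fst l \<le> fst u" "snd l \<le> snd u"
    using lu[of "(1, 0)"] lu[of "(0, 1)"] by (auto simp: Basis_prod_def inner_prod_def)
  let ?v = "\<lambda>z::real\<times>real. vector [fst z, snd z] :: real^2"
  have pre: "(\<lambda>q::real^2. (q $ 1, q $ 2)) -` box l u = box (?v l) (?v u)"
    by (cases l; cases u) (auto simp: box_def Basis_vec_def Basis_prod_def inner_axis forall_2)
  have "emeasure (distr lborel borel (\<lambda>q::real^2. (q $ 1, q $ 2))) (box l u)
      = emeasure lborel (box (?v l) (?v u))"
    using meas by (subst emeasure_distr) (auto simp: pre)
  also have "\<dots> = (\<Prod>b\<in>Basis. (?v u - ?v l) \<bullet> b)"
    by (rule emeasure_lborel_box) (use le in \<open>auto simp: Basis_vec_def inner_axis forall_2 UNIV_2\<close>)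
  also have "(\<Prod>b\<in>Basis. (?v u - ?v l) \<bullet> b) = (fst u - fst l) * (snd u - snd l)"
  proof -
    have b: "Basis = {axis 1 1, axis 2 1 :: real^2}" by (auto simp: Basis_vec_def UNIV_2)
    have "axis 1 1 \<noteq> (axis 2 1 :: real^2)" by (simp add: axis_eq_axis)
    then show ?thesis unfolding b by (simp add: inner_axis)
  qed
  also have "\<dots> = (\<Prod>b\<in>Basis. (u - l) \<bullet> b)"
    by (cases l; cases u) (simp add: Basis_prod_def)
  finally show "emeasure (distr lborel borel (\<lambda>q::real^2. (q $ 1, q $ 2))) (box l u)
      = ennreal (\<Prod>b\<in>Basis. (u - l) \<bullet> b)" .
qed simp

definition to_plane :: "real^2 \<Rightarrow> real \<times> real" where "to_plane q = (q $ 1, q $ 2)"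

lemma to_plane_measurable: "to_plane \<in> borel_measurable borel"
  unfolding to_plane_def[abs_def] by (intro borel_measurable_continuous_onI continuous_intros)

lemma
  assumes "integrable lborel g"
  shows integrable_to_plane: "integrable lborel (\<lambda>q. g (to_plane q))"
    and integral_to_plane: "integral\<^sup>L lborel (\<lambda>q. g (to_plane q)) = (integral\<^sup>L lborel g :: real)"
proof -
  have d: "lborel = distr (lborel :: (real^2) measure) borel to_plane"
    using lborel_plane by (simp add: to_plane_def[abs_def])
  have "integrable (distr lborel borel to_plane) g"
    using assms by (simp flip: d)
  then show "integrable lborel (\<lambda>q. g (to_plane q))"
    by (subst (asm) integrable_distr_eq) (use to_plane_measurable borel_measurable_integrable[OF assms] in auto)
  have "integral\<^sup>L (distr lborel borel to_plane) g = integral\<^sup>L lborel (\<lambda>q. g (to_plane q))"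
    by (rule integral_distr) (use to_plane_measurable borel_measurable_integrable[OF assms] in auto)
  then show "integral\<^sup>L lborel (\<lambda>q. g (to_plane q)) = integral\<^sup>L lborel g"
    by (simp flip: d)
qed

lemma perp_component: "perp k $ 1 = - (k $ 2)" "perp k $ 2 = k $ 1"
  by (simp_all add: perp_def)

lemma inner_2: "x \<bullet> y = x $ 1 * y $ 1 + x $ 2 * (y $ 2)" for x y :: "real^2"
  by (simp add: inner_vec_def sum_2)

lemma norm_sq_2: "norm k ^ 2 = (k $ 1) ^ 2 + (k $ 2) ^ 2" for k :: "real^2"
  unfolding power2_norm_eq_inner inner_2 by (simp add: power2_eq_square)

text \<open>
  Jet coordinates of a point for the jet vector \<open>k\<close>: a rotation followed by scaling with \<open>norm k\<close>.
\<close>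

definition frame :: "real^2 \<Rightarrow> real^2 \<Rightarrow> real \<times> real" where
  "frame k p = (k \<bullet> p, perp k \<bullet> p)"

lemma lborel_frame:
  fixes h :: "real^2 \<Rightarrow> real^2"
  assumes k: "k \<noteq> 0" and h: "integrable lborel h" "continuous_on UNIV h"
  defines "L \<equiv> \<lambda>p. vector [k \<bullet> p, perp k \<bullet> p] :: real^2"
  shows "integrable lborel (\<lambda>p. h (L p))"
    and "integral\<^sup>L lborel h = (norm k) ^ 2 *\<^sub>R integral\<^sup>L lborel (\<lambda>p. h (L p))"
proof -
  have lin: "linear L"
    unfolding L_def by (rule linearI) (auto simp: vec_eq_iff forall_2 inner_add_right)
  have det: "det (matrix L) = norm k ^ 2"
    unfolding norm_sq_2
    by (simp add: det_2 matrix_def L_def inner_axis perp_component) (simp add: power2_eq_square)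
  then have det_nz: "det (matrix L) \<noteq> 0" using k by simp
  then have surj: "L ` UNIV = UNIV"
    using lin det_nz_iff_inj linear_injective_imp_surjective by blast
  have hm: "h \<in> borel_measurable lborel"
    using h(2) borel_measurable_continuous_onI by simp
  have Lc: "continuous_on UNIV L" using lin linear_continuous_on linear_conv_bounded_linear by blast
  have "continuous_on UNIV (\<lambda>p. h (L p))"
    by (rule continuous_on_compose2[OF h(2) Lc]) auto
  then have hLm: "(\<lambda>p. h (L p)) \<in> borel_measurable lborel"
    using borel_measurable_continuous_onI by simp
  have "integrable lebesgue h" using h(1) hm by (simp add: integrable_completion)
  then have ah: "h absolutely_integrable_on (L ` UNIV)"
    unfolding surj by (simp add: set_integrable_def)
  then have ahL: "(h \<circ> L) absolutely_integrable_on UNIV"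
    using absolutely_integrable_on_linear_image[OF lin] det_nz by blast
  then have "integrable lebesgue (\<lambda>p. h (L p))" by (simp add: set_integrable_def o_def)
  then show i: "integrable lborel (\<lambda>p. h (L p))" using hLm by (simp add: integrable_completion)
  have "integral\<^sup>L lborel g = integral UNIV g" if "integrable lborel g" for g :: "real^2 \<Rightarrow> real^2"
    using has_integral_integral_lborel[OF that] by (simp add: integral_unique)
  moreover have "integral UNIV h = norm k ^ 2 *\<^sub>R integral UNIV (h \<circ> L)"
    using integral_change_of_variables_linear[OF lin disjI1[OF ah]] det surj by simp
  ultimately show "integral\<^sup>L lborel h = (norm k) ^ 2 *\<^sub>R integral\<^sup>L lborel (\<lambda>p. h (L p))"
    using h(1) i by (simp add: o_def)
qed

lemma frame_integral:
  assumes k: "k \<noteq> 0" and g1: "symb 7 g1" and g2: "symb 7 g2"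
  defines "f \<equiv> \<lambda>p. norm k ^ 2 *\<^sub>R (g1 (frame k p) *\<^sub>R k + g2 (frame k p) *\<^sub>R perp k)"
  shows "integrable lborel f" "integral\<^sup>L lborel f = (integral\<^sup>L lborel g1) *\<^sub>R k + (integral\<^sup>L lborel g2) *\<^sub>R perp k"
proof -
  define h where "h q = g1 (to_plane q) *\<^sub>R k + g2 (to_plane q) *\<^sub>R perp k" for q
  let ?L = "\<lambda>p. vector [k \<bullet> p, perp k \<bullet> p] :: real^2"
  note i = symb7_integrable[OF g1] symb7_integrable[OF g2]
  have h: "integrable lborel h"
    unfolding h_def[abs_def]
    by (intro Bochner_Integration.integrable_add integrable_scaleR_left integrable_to_plane i)
  have c: "continuous_on UNIV h"
    unfolding h_def[abs_def] to_plane_def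
    by (intro continuous_intros continuous_on_compose2[OF symb_continuous[OF g1, of UNIV]]
        continuous_on_compose2[OF symb_continuous[OF g2, of UNIV]]) auto
  have eq: "f = (\<lambda>p. norm k ^ 2 *\<^sub>R h (?L p))"
    by (simp add: f_def h_def frame_def to_plane_def)
  show "integrable lborel f"
    unfolding eq using lborel_frame(1)[OF k h c] by (intro integrable_scaleR_right)
  have "integral\<^sup>L lborel f = integral\<^sup>L lborel h"
    unfolding eq lborel_frame(2)[OF k h c] by simp
  also have "\<dots> = (integral\<^sup>L lborel g1) *\<^sub>R k + (integral\<^sup>L lborel g2) *\<^sub>R perp k"
    unfolding h_def[abs_def]
    by (subst Bochner_Integration.integral_add) 
      (auto intro!: integrable_scaleR_left integrable_to_plane i
        simp: integral_to_plane[OF i(1)] integral_to_plane[OF i(2)] Bochner_Integration.integral_scaleR_left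
          integrable_to_plane[OF i(1)] integrable_to_plane[OF i(2)])
  finally show "integral\<^sup>L lborel f = (integral\<^sup>L lborel g1) *\<^sub>R k + (integral\<^sup>L lborel g2) *\<^sub>R perp k" .
qed

lemma periodic_integral:
  fixes h :: "real \<Rightarrow> real"
  assumes cont: "continuous_on UNIV h" and per: "\<And>t. h (t + p) = h t" and p: "0 \<le> p"
  shows "integral {a..a + p} h = integral {b..b + p} h"
proof -
  define lo hi where "lo = min a b" and "hi = max a b + p"
  \<comment> \<open>With an antiderivative \<open>H\<close> on an interval containing both periods, \<open>H (c + p) - H c\<close> is constant in \<open>c\<close>.\<close>
  obtain H where H: "\<And>t. t \<in> {lo..hi} \<Longrightarrow> (H has_vector_derivative h t) (at t within {lo..hi})"
    using antiderivative_continuous[of lo hi h] cont continuous_on_subset by blast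
  have I: "integral {c..c + p} h = H (c + p) - H c" if "c \<in> {lo..hi - p}" for c
  proof (intro integral_unique fundamental_theorem_of_calculus)
    fix t assume "t \<in> {c..c + p}"
    then show "(H has_vector_derivative h t) (at t within {c..c + p})"
      using that by (intro has_vector_derivative_within_subset[OF H]) auto
  qed (use p in auto)
  have "\<exists>K. \<forall>c\<in>{lo..hi - p}. H (c + p) - H c = K"
  proof (rule has_vector_derivative_zero_constant)
    fix c assume c: "c \<in> {lo..hi - p}"
    have "((\<lambda>c. c + p) has_vector_derivative 1) (at c within {lo..hi - p})"
      by (auto intro!: derivative_eq_intros)
    moreover have "(H has_vector_derivative h (c + p)) (at (c + p) within (\<lambda>c. c + p) ` {lo..hi - p})"
      using c p by (intro has_vector_derivative_within_subset[OF H]) auto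
    ultimately have "(H \<circ> (\<lambda>c. c + p) has_vector_derivative 1 *\<^sub>R h (c + p)) (at c within {lo..hi - p})"
      by (rule vector_diff_chain_within)
    moreover have "(H has_vector_derivative h c) (at c within {lo..hi - p})"
      using c p by (intro has_vector_derivative_within_subset[OF H]) auto
    ultimately show "((\<lambda>c. H (c + p) - H c) has_vector_derivative 0) (at c within {lo..hi - p})"
      using has_vector_derivative_diff per by (fastforce simp: o_def)
  qed (rule convex_real_interval, blast)
  moreover have "a \<in> {lo..hi - p}" "b \<in> {lo..hi - p}" by (auto simp: lo_def hi_def)
  ultimately show ?thesis using I by metis
qed

lemma periodic_integral_shift:
  fixes h :: "real \<Rightarrow> real"
  assumes "continuous_on UNIV h" "\<And>t. h (t + p) = h t" "0 \<le> p"
  shows "integral {0..p} (\<lambda>t. h (t - s)) = integral {b..b + p} h"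
proof -
  have "(h has_integral integral {- s..- s + p} h) {- s..- s + p}"
    using integrable_continuous_real assms(1) continuous_on_subset by blast
  then have "((\<lambda>t. h (t - s)) has_integral integral {- s..- s + p} h) {0..p}"
    using has_integral_affinity[of h _ "- s" "- s + p" 1 "- s"] by (simp add: image_affinity_atLeastAtMost)
  then show ?thesis using periodic_integral[OF assms, of "- s" b] by (simp add: integral_unique)
qed

section \<open>Fields on the Euclidean plane\<close>

text \<open>
  The field with coefficients \<open>g1\<close>, \<open>g2\<close> along \<open>a\<close>, \<open>b\<close>, evaluated in the frame of \<open>k\<close>.  With
  \<open>a = k\<close>, \<open>b = perp k\<close> it is a velocity; a scalar field is the case \<open>b = 0\<close>.
\<close>

definition planar :: "real^2 \<Rightarrow> 'b \<Rightarrow> 'b \<Rightarrow> (real \<times> real \<Rightarrow> real) \<Rightarrow> (real \<times> real \<Rightarrow> real) \<Rightarrow> real^2 \<Rightarrow> 'b::real_normed_vector" where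
  "planar k a b g1 g2 p = g1 (frame k p) *\<^sub>R a + g2 (frame k p) *\<^sub>R b"

text \<open>
  The derivative along the \<open>i\<close>-th coordinate axis of \<^typ>\<open>real^2\<close>, expressed in jet coordinates.
\<close>

definition dirder :: "real^2 \<Rightarrow> 2 \<Rightarrow> (real \<times> real \<Rightarrow> real) \<Rightarrow> real \<times> real \<Rightarrow> real" where
  "dirder k i g z = k $ i * dx g z + perp k $ i * dy g z"

lemma planar_has_derivative:
  assumes "symb m g1" "symb n g2"
  shows "(planar k a b g1 g2 has_derivative
    (\<lambda>h. (dx g1 (frame k p) * (k \<bullet> h) + dy g1 (frame k p) * (perp k \<bullet> h)) *\<^sub>R a
       + (dx g2 (frame k p) * (k \<bullet> h) + dy g2 (frame k p) * (perp k \<bullet> h)) *\<^sub>R b)) (at p)"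
proof -
  have fr: "(frame k has_derivative (\<lambda>h. (k \<bullet> h, perp k \<bullet> h))) (at p)"
    unfolding frame_def[abs_def] by (auto intro!: derivative_eq_intros)
  have "((\<lambda>p. g (frame k p)) has_derivative
      (\<lambda>h. dx g (frame k p) * (k \<bullet> h) + dy g (frame k p) * (perp k \<bullet> h))) (at p)" if "symb l g" for g l
    using has_derivative_compose[OF fr symb_has_grad[OF that, unfolded has_grad_def, rule_format]] by simp
  from this[OF assms(1)] this[OF assms(2)] show ?thesis
    unfolding planar_def[abs_def] by (intro has_derivative_add has_derivative_scaleR_left)
qed

lemma partial_planar:
  assumes "symb m g1" "symb n g2"
  shows "partial i (planar k a b g1 g2) = planar k a b (dirder k i g1) (dirder k i g2)"
proof
  fix p
  show "partial i (planar k a b g1 g2) p = planar k a b (dirder k i g1) (dirder k i g2) p"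
    unfolding partial_def frechet_derivative_at[OF planar_has_derivative[OF assms], symmetric]
    by (simp add: planar_def dirder_def inner_axis mult.commute)
qed

lemma symb_dirder: "symb n g \<Longrightarrow> symb n (dirder k i g)"
  unfolding dirder_def[abs_def]
  by (intro symb_add symb_cmult symb_mono[OF _ symb_dx] symb_mono[OF _ symb_dy]) auto

text \<open>
  Since partial derivatives of planar fields with symbol coefficients are again of this form, all of
  them are smooth.
\<close>

lemma C_k_planar: "symb m g1 \<Longrightarrow> symb n g2 \<Longrightarrow> C_k l (planar k a b g1 g2)"
proof (induction l arbitrary: g1 g2)
  case 0
  then show ?case
    using has_derivative_continuous[OF planar_has_derivative[OF 0, of k a b]]
    by (simp add: continuous_at_imp_continuous_on)
next
  case (Suc l)
  then show ?case
    using differentiableI[OF planar_has_derivative[OF Suc.prems, of k a b]] by (simp add: partial_planar symb_dirder)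
qed

lemma smooth_planar: "symb m g1 \<Longrightarrow> symb n g2 \<Longrightarrow> smooth (planar k a b g1 g2)"
  unfolding smooth_def by (blast intro: C_k_planar)

lemma dirder_dirder:
  assumes "symb n g"
  shows "dirder k 1 (dirder k 1 g) z + dirder k 2 (dirder k 2 g) z = norm k ^ 2 * (dx (dx g) z + dy (dy g) z)"
proof -
  have "dx (dirder k i g) z = k $ i * dx (dx g) z + perp k $ i * dx (dy g) z"
    "dy (dirder k i g) z = k $ i * dy (dx g) z + perp k $ i * dy (dy g) z" for i
    unfolding dirder_def[abs_def]
    by (rule dx_eqI dy_eqI, (rule has_grad_add has_grad_mult has_grad_const
          symb_has_grad[OF symb_dx[OF assms]] symb_has_grad[OF symb_dy[OF assms]])+, simp)+
  then show ?thesis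
    unfolding dirder_def[of _ _ "dirder _ _ _"] norm_sq_2
    by (simp add: perp_component power2_eq_square algebra_simps)
qed

lemma dirder_sum: "k $ 1 * dirder k 1 g z + k $ 2 * dirder k 2 g z = norm k ^ 2 * dx g z"
  "perp k $ 1 * dirder k 1 g z + perp k $ 2 * dirder k 2 g z = norm k ^ 2 * dy g z"
  unfolding dirder_def norm_sq_2 perp_component by algebra+

text \<open>
  The velocity scales with \<open>norm k\<close>, the pressure with its square and the force with its cube, as the
  scaling symmetry of the equations demands.
\<close>

lemma navier_stokes_planar:
  "navier_stokes (planar k k (perp k) vel1 vel2) (planar k (norm k ^ 2) 0 pres (\<lambda>_. 0))
     (planar k (norm k ^ 2 *\<^sub>R k) (norm k ^ 2 *\<^sub>R perp k) force1 force2)"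
proof -
  let ?U = "planar k k (perp k) vel1 vel2" and ?P = "planar k (norm k ^ 2) 0 pres (\<lambda>_. 0)"
  let ?f = "planar k (norm k ^ 2 *\<^sub>R k) (norm k ^ 2 *\<^sub>R perp k) force1 force2"
  have pU: "partial i ?U = planar k k (perp k) (dirder k i vel1) (dirder k i vel2)" for i
    by (rule partial_planar[OF symb_vel1 symb_vel2])
  have ppU: "partial i (partial i ?U) = planar k k (perp k) (dirder k i (dirder k i vel1)) (dirder k i (dirder k i vel2))" for i
    unfolding pU by (rule partial_planar[OF symb_dirder[OF symb_vel1] symb_dirder[OF symb_vel2]])
  have pP: "partial i ?P = planar k (norm k ^ 2) 0 (dirder k i pres) (dirder k i (\<lambda>_. 0))" for i
    by (rule partial_planar[OF symb_pres symb_zero])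
  show ?thesis
    unfolding navier_stokes_def
  proof (intro allI conjI)
    fix p
    let ?z = "frame k p"
    have lap: "laplacian ?U p = (norm k ^ 2 * (dx (dx vel1) ?z + dy (dy vel1) ?z)) *\<^sub>R k
        + (norm k ^ 2 * (dx (dx vel2) ?z + dy (dy vel2) ?z)) *\<^sub>R perp k"
      unfolding laplacian_def ppU sum_2 planar_def dirder_dirder[OF symb_vel1, symmetric] dirder_dirder[OF symb_vel2, symmetric]
      by (simp add: algebra_simps)
    have grad: "gradient ?P p = norm k ^ 2 *\<^sub>R (dx pres ?z *\<^sub>R k + dy pres ?z *\<^sub>R perp k)"
      unfolding gradient_def pP planar_def
      by (simp add: vec_eq_iff forall_2 dirder_def algebra_simps)
    have adv: "advection ?U ?U p = norm k ^ 2 *\<^sub>R ((vel1 ?z * dx vel1 ?z + vel2 ?z * dy vel1 ?z) *\<^sub>R k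
        + (vel1 ?z * dx vel2 ?z + vel2 ?z * dy vel2 ?z) *\<^sub>R perp k)"
    proof -
      have *: "(vel1 ?z * k $ 1 + vel2 ?z * perp k $ 1) * dirder k 1 g ?z + (vel1 ?z * k $ 2 + vel2 ?z * perp k $ 2) * dirder k 2 g ?z
          = norm k ^ 2 * (vel1 ?z * dx g ?z + vel2 ?z * dy g ?z)" for g
        using dirder_sum[of k g ?z] by algebra
      have "advection ?U ?U p = ((vel1 ?z * k $ 1 + vel2 ?z * perp k $ 1) * dirder k 1 vel1 ?z
            + (vel1 ?z * k $ 2 + vel2 ?z * perp k $ 2) * dirder k 2 vel1 ?z) *\<^sub>R k
          + ((vel1 ?z * k $ 1 + vel2 ?z * perp k $ 1) * dirder k 1 vel2 ?z
            + (vel1 ?z * k $ 2 + vel2 ?z * perp k $ 2) * dirder k 2 vel2 ?z) *\<^sub>R perp k"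
        unfolding advection_def pU sum_2 by (simp add: planar_def algebra_simps)
      then show ?thesis unfolding * by (simp add: scaleR_add_right)
    qed
    show "laplacian ?U p - gradient ?P p = advection ?U ?U p + ?f p"
      unfolding lap grad adv planar_def force1_def force2_def by (simp add: algebra_simps)
    have "divergence ?U p = (k $ 1 * dirder k 1 vel1 ?z + k $ 2 * dirder k 2 vel1 ?z)
        + (perp k $ 1 * dirder k 1 vel2 ?z + perp k $ 2 * dirder k 2 vel2 ?z)"
      unfolding divergence_def pU sum_2 by (simp add: planar_def algebra_simps)
    then show "divergence ?U p = 0"
      unfolding dirder_sum by (simp add: div_free)
  qed
qed

lemma stress_planar:
  fixes k n :: "real^2"
  defines "U \<equiv> planar k k (perp k) vel1 vel2" and "P \<equiv> planar k (norm k ^ 2) 0 pres (\<lambda>_. 0)"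
  shows "stress_tensor U P p *v n =
    (stress11 (frame k p) * (k \<bullet> n) + stress12 (frame k p) * (perp k \<bullet> n)) *\<^sub>R k
    + (stress12 (frame k p) * (k \<bullet> n) + stress22 (frame k p) * (perp k \<bullet> n)) *\<^sub>R perp k"
proof -
  let ?z = "frame k p"
  have J: "jacobian U (at p) $ i $ j = dirder k j vel1 ?z * k $ i + dirder k j vel2 ?z * perp k $ i" for i j
  proof -
    have "jacobian U (at p) $ i $ j = partial j U p $ i"
      by (simp add: jacobian_def matrix_def partial_def)
    then show ?thesis
      unfolding U_def partial_planar[OF symb_vel1 symb_vel2] by (simp add: planar_def)
  qed
  have U: "U p $ i = vel1 ?z * k $ i + vel2 ?z * perp k $ i" for i by (simp add: U_def planar_def)
  have P: "P p = ((k $ 1) ^ 2 + (k $ 2) ^ 2) * pres ?z" by (simp add: P_def planar_def norm_sq_2)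
  have m: "mat c $ i $ j = (if i = j then c else (0::real))" for c and i j :: 2 by (simp add: mat_def)
  have "(stress_tensor U P p *v n) $ i = ((stress11 ?z * (k \<bullet> n) + stress12 ?z * (perp k \<bullet> n)) *\<^sub>R k
    + (stress12 ?z * (k \<bullet> n) + stress22 ?z * (perp k \<bullet> n)) *\<^sub>R perp k) $ i" if "i = 1 \<or> i = 2" for i
    using that unfolding stress_tensor_def matrix_vector_mult_def tensor_product_def
    by (elim disjE)
      (simp_all add: sum_2 transpose_def J U P m dirder_def stress11_def stress12_def stress22_def inner_2 perp_component
        power2_eq_square algebra_simps)
  then show ?thesis by (simp add: vec_eq_iff forall_2)
qed

lemma circle_flux_planar:
  assumes k: "k \<noteq> 0"
  shows "(circle_flux (stress_tensor (planar k k (perp k) vel1 vel2) (planar k (norm k ^ 2) 0 pres (\<lambda>_. 0)))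
    \<longlongrightarrow> - 48 *\<^sub>R k) at_top"
proof -
  let ?T = "stress_tensor (planar k k (perp k) vel1 vel2) (planar k (norm k ^ 2) 0 pres (\<lambda>_. 0))"
  \<comment> \<open>In polar angle measured from \<open>k\<close> the integrand is the flux in jet coordinates; its period absorbs the shift.\<close>
  have "(k $ 1 / norm k) ^ 2 + (k $ 2 / norm k) ^ 2 = 1"
    using k by (simp add: power_divide norm_sq_2[symmetric] flip: add_divide_distrib)
  then obtain s where "k $ 1 / norm k = cos s" "k $ 2 / norm k = sin s"
    using sincos_total_2pi_le by blast
  then have s: "k $ 1 = norm k * cos s" "k $ 2 = norm k * sin s" using k by (auto simp: field_simps)
  have kn: "k \<bullet> unit_normal t = norm k * cos (t - s)" "perp k \<bullet> unit_normal t = norm k * sin (t - s)" for t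
    unfolding inner_2 perp_component s by (simp_all add: unit_normal_def cos_diff sin_diff algebra_simps)
  have fr: "frame k (R *\<^sub>R unit_normal t) = circ (norm k * R) (t - s)" for R t
    by (simp add: frame_def circ_def kn mult_ac)
  have flux: "circle_flux ?T R = (integral {0..2*pi} (flux1 (norm k * R))) *\<^sub>R k" for R
  proof -
    let ?r = "norm k * R"
    have per: "flux1 ?r (t + 2*pi) = flux1 ?r t" "flux2 ?r (t + 2*pi) = flux2 ?r t" for t
      by (simp_all add: flux1_def flux2_def circ_def)
    have i1: "integral {0..2*pi} (\<lambda>t. flux1 ?r (t - s)) = integral {0..2*pi} (flux1 ?r)"
      using periodic_integral_shift[OF continuous_flux(1) per(1), where b = 0] by simp
    have i2: "integral {0..2*pi} (\<lambda>t. flux2 ?r (t - s)) = 0"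
      using periodic_integral_shift[OF continuous_flux(2) per(2), where b = "- pi"] circle_flux2 by simp
    have c: "continuous_on S (\<lambda>t. flux1 ?r (t - s))" "continuous_on S (\<lambda>t. flux2 ?r (t - s))" for S
      by (rule continuous_on_compose2[OF continuous_flux(1)[of UNIV]] continuous_on_compose2[OF continuous_flux(2)[of UNIV]],
          auto intro!: continuous_intros)+
    have "((\<lambda>t. flux1 ?r (t - s)) has_integral integral {0..2*pi} (flux1 ?r)) {0..2*pi}"
      "((\<lambda>t. flux2 ?r (t - s)) has_integral 0) {0..2*pi}"
      using c(1)[of "{0..2*pi}", THEN integrable_continuous_real, THEN integrable_integral]
        c(2)[of "{0..2*pi}", THEN integrable_continuous_real, THEN integrable_integral]
      by (simp_all only: i1 i2)
    then have "((\<lambda>t. flux1 ?r (t - s) *\<^sub>R k + flux2 ?r (t - s) *\<^sub>R perp k) has_integral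
        (integral {0..2*pi} (flux1 ?r) *\<^sub>R k + 0 *\<^sub>R perp k)) {0..2*pi}"
      by (intro has_integral_add has_integral_scaleR_left)
    moreover have "R *\<^sub>R (?T (R *\<^sub>R unit_normal t) *v unit_normal t)
        = flux1 ?r (t - s) *\<^sub>R k + flux2 ?r (t - s) *\<^sub>R perp k" for t
      unfolding stress_planar fr kn flux1_def flux2_def by (simp add: algebra_simps)
    ultimately show ?thesis
      unfolding circle_flux_def by (simp add: integral_unique)
  qed
  have "filterlim (\<lambda>R. norm k * R) at_top at_top"
    using k by (intro filterlim_tendsto_pos_mult_at_top[OF tendsto_const] filterlim_ident) auto
  from filterlim_compose[OF circle_flux1 this]
  show ?thesis unfolding flux[abs_def] by (intro tendsto_scaleR tendsto_const)
qed

lemma norm_perp: "norm (perp k) = norm k"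
  by (rule power2_eq_imp_eq) (simp_all add: norm_sq_2 perp_component)

lemma symb_bigo:
  assumes k: "k \<noteq> 0" and g: "symb n g"
  shows "(\<lambda>p. g (frame k p)) \<in> O[at_infinity](\<lambda>p. norm p powr (- real n / 3))"
proof -
  obtain C where C: "\<And>z. \<bar>g z\<bar> \<le> C * lam z ^ n" using symb_bound[OF g] by blast
  have C0: "0 \<le> C" using C[of "(0,0)"] lam_pos[of "(0,0)"]
    by (smt (verit) abs_ge_zero mult_neg_pos zero_less_power)
  have lam_le: "lam (frame k p) ^ n \<le> norm k powr (- real n / 3) * norm p powr (- real n / 3)" if "p \<noteq> 0" for p
  proof -
    have pos: "0 < norm k * norm p" using k that by simp
    have "fst (frame k p) ^ 2 + snd (frame k p) ^ 2 = (norm k * norm p) ^ 2"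
      unfolding power_mult_distrib norm_sq_2 by (simp add: frame_def inner_2 perp_component) algebra
    then have "lam (frame k p) = (1 + (norm k * norm p) ^ 2) powr (- 1 / 6)" by (simp add: lam_def add.assoc)
    also have "\<dots> \<le> ((norm k * norm p) ^ 2) powr (- 1 / 6)"
      using pos by (intro powr_mono2') auto
    also have "\<dots> = ((norm k * norm p) powr 2) powr (- 1 / 6)" using pos by simp
    also have "\<dots> = (norm k * norm p) powr (- 1 / 3)" by (simp only: powr_powr) simp
    finally have "lam (frame k p) ^ n \<le> ((norm k * norm p) powr (- 1 / 3)) ^ n"
      using lam_pos[of "frame k p"] by (intro power_mono) auto
    also have "\<dots> = ((norm k * norm p) powr (- 1 / 3)) powr real n"
      using k that by (intro powr_realpow[symmetric]) simp
    also have "\<dots> = (norm k * norm p) powr (- real n / 3)" by (simp only: powr_powr) simp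
    finally show ?thesis by (simp add: powr_mult)
  qed
  have "eventually (\<lambda>p::real^2. p \<noteq> 0) at_infinity"
    by (rule eventually_at_infinityI[of 1]) auto
  then have "eventually (\<lambda>p. norm (g (frame k p)) \<le> (C * norm k powr (- real n / 3)) * norm (norm p powr (- real n / 3))) at_infinity"
  proof eventually_elim
    case (elim p)
    have "\<bar>g (frame k p)\<bar> \<le> C * lam (frame k p) ^ n" by (rule C)
    also have "\<dots> \<le> C * (norm k powr (- real n / 3) * norm p powr (- real n / 3))"
      by (intro mult_left_mono lam_le elim C0)
    finally show ?case by (simp add: mult.assoc)
  qed
  then show ?thesis by (rule bigoI)
qed

theorem proposition5p1:
  fixes F :: "real^2"
  assumes "F \<noteq> 0"
  shows "\<exists>(U :: real^2 \<Rightarrow> real^2) (P :: real^2 \<Rightarrow> real) (f :: real^2 \<Rightarrow> real^2).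
    smooth U \<and> smooth P \<and> smooth f \<and>
    navier_stokes U P f \<and>
    has_net_force U P f F \<and>
    (\<lambda>x. norm (U x)) \<in> O[at_infinity](\<lambda>x. norm x powr (-1/3)) \<and>
    P \<in> O[at_infinity](\<lambda>x. norm x powr (-2/3)) \<and>
    (\<lambda>x. component_along F (f x)) \<in> O[at_infinity](\<lambda>x. norm x powr (-7/3)) \<and>
    (\<lambda>x. component_along (perp F) (f x)) \<in> O[at_infinity](\<lambda>x. norm x powr (-8/3))"
proof -
  \<comment> \<open>The jet of unit strength has net force \<open>- 48\<close> along its direction.\<close>
  define k where "k = (- 1 / 48) *\<^sub>R F"
  have F: "F = - 48 *\<^sub>R k" and k: "k \<noteq> 0" using assms by (auto simp: k_def)
  define U where "U = planar k k (perp k) vel1 vel2"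
  define P where "P = planar k (norm k ^ 2) 0 pres (\<lambda>_. 0)"
  define f where "f = planar k (norm k ^ 2 *\<^sub>R k) (norm k ^ 2 *\<^sub>R perp k) force1 force2"
  have f_eq: "f = (\<lambda>p. norm k ^ 2 *\<^sub>R (force1 (frame k p) *\<^sub>R k + force2 (frame k p) *\<^sub>R perp k))"
    by (simp add: f_def planar_def fun_eq_iff algebra_simps)
  have orth: "k \<bullet> perp k = 0" "perp k \<bullet> k = 0" by (simp_all add: inner_2 perp_component)
  have sm: "smooth U" "smooth P" "smooth f"
    unfolding U_def P_def f_def
    by (rule smooth_planar[OF symb_vel1 symb_vel2] smooth_planar[OF symb_pres symb_zero] smooth_planar[OF symb_force1 symb_force2])+
  have net: "has_net_force U P f F"
    unfolding has_net_force_def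
  proof (intro conjI)
    show "integrable lborel f" "integral\<^sup>L lborel f = F"
      unfolding f_eq using frame_integral[OF k symb_force1 symb_force2_7] by (simp_all add: integral_force1 integral_force2 F)
    show "(circle_flux (stress_tensor U P) \<longlongrightarrow> F) at_top"
      unfolding U_def P_def F by (rule circle_flux_planar[OF k])
  qed
  have bU: "(\<lambda>x. norm (U x)) \<in> O[at_infinity](\<lambda>x. norm x powr (-1/3))"
  proof -
    have "(\<lambda>x. vel1 (frame k x)) \<in> O[at_infinity](\<lambda>x. norm x powr (-1/3))"
      "(\<lambda>x. vel2 (frame k x)) \<in> O[at_infinity](\<lambda>x. norm x powr (-1/3))"
      using symb_bigo[OF k symb_vel1] symb_bigo[OF k symb_mono[of 1 2 vel2, OF _ symb_vel2]] by simp_all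
    then have "(\<lambda>x. \<bar>vel1 (frame k x)\<bar> * norm k + \<bar>vel2 (frame k x)\<bar> * norm k) \<in> O[at_infinity](\<lambda>x. norm x powr (-1/3))"
      using k by (intro sum_in_bigo) simp_all
    moreover have "(\<lambda>x. norm (U x)) \<in> O[at_infinity](\<lambda>x. \<bar>vel1 (frame k x)\<bar> * norm k + \<bar>vel2 (frame k x)\<bar> * norm k)"
    proof (rule bigoI[where c = 1], rule always_eventually, rule allI)
      fix x
      have "norm (U x) \<le> norm (vel1 (frame k x) *\<^sub>R k) + norm (vel2 (frame k x) *\<^sub>R perp k)"
        unfolding U_def planar_def by (rule norm_triangle_ineq)
      then show "norm (norm (U x)) \<le> 1 * norm (\<bar>vel1 (frame k x)\<bar> * norm k + \<bar>vel2 (frame k x)\<bar> * norm k)"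
        by (simp add: norm_perp)
    qed
    ultimately show ?thesis using landau_o.big_trans by blast
  qed
  have bP: "P \<in> O[at_infinity](\<lambda>x. norm x powr (-2/3))"
    using symb_bigo[OF k symb_mono[of 2 4 pres, OF _ symb_pres]] k by (simp add: P_def planar_def[abs_def])
  have "component_along F (f x) = (- (norm k ^ 3)) * force1 (frame k x)" for x
  proof -
    have "component_along F (f x) = (norm k ^ 2 * (force1 (frame k x) * (- 48 * norm k ^ 2))) / (48 * norm k)"
      unfolding component_along_def f_eq F
      by (simp add: inner_add_left orth power2_norm_eq_inner)
    then show ?thesis using k by (simp add: field_simps eval_nat_numeral)
  qed
  then have b1: "(\<lambda>x. component_along F (f x)) \<in> O[at_infinity](\<lambda>x. norm x powr (-7/3))"
    using symb_bigo[OF k symb_force1] k by simp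
  have "perp F = - 48 *\<^sub>R perp k" by (simp add: F vec_eq_iff forall_2 perp_component)
  then have "component_along (perp F) (f x) = (- (norm k ^ 3)) * force2 (frame k x)" for x
  proof -
    have "component_along (perp F) (f x) = (norm k ^ 2 * (force2 (frame k x) * (- 48 * norm (perp k) ^ 2))) / (48 * norm (perp k))"
      unfolding component_along_def f_eq \<open>perp F = _\<close>
      by (simp add: inner_add_left orth power2_norm_eq_inner)
    then show ?thesis using k unfolding norm_perp by (simp add: field_simps eval_nat_numeral)
  qed
  then have b2: "(\<lambda>x. component_along (perp F) (f x)) \<in> O[at_infinity](\<lambda>x. norm x powr (-8/3))"
    using symb_bigo[OF k symb_force2] k by simp
  show ?thesis
    using sm net bU bP b1 b2 navier_stokes_planar[of k, folded U_def P_def f_def] by blast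
qed

end
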